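(* Let $(V,E)$ be a finite, undirected, simple, connected graph with maximum degree $\Delta=\sup_{x\in V}|N_x|$, and let $\rho>0$. Consider the hardcore model on $(V,E)$ with parameter $\rho$. Assume that $\rho\Delta\le1$ and set $$\kappa=1-\rho(\Delta-1),\qquad\bar\kappa=\min\{\rho,1-\rho\Delta\}.$$ Then: (i) for every admissible $\phi$ the convex Sobolev inequality holds with $\kappa_\phi=\kappa$; (ii) the modified logarithmic Sobolev inequality holds with $\kappa_1=\kappa+2\bar\kappa$; (iii) for every $\alpha\in(1,2]$ the Beckner inequality holds with $\kappa_\alpha=\alpha\kappa$.
   Context: Hardcore model: write $x\sim y$ if $(x,y)\in E$, $N_x=\{y\ne x:y\sim x\}$, $\bar N_x=N_x\cup\{x\}$. State space $\Omega=\{\eta:V\to\{0,1\}:\eta_x\eta_y=0\ \forall x\sim y\}$; $(\delta_x)_y=1$ if $y=x$ and $0$ otherwise. Moves $G=\{\gamma_x^+,\gamma_x^-:x\in V\}$ with $\gamma_x^\pm\eta=\eta\pm\delta_x$ if $\eta\pm\delta_x\in\Omega$ and $\gamma_x^\pm\eta=\eta$ otherwise. Rates $c(\eta,\gamma_x^-)=\eta_x$ and $c(\eta,\gamma_x^+)=\rho\prod_{y\in\bar N_x}(1-\eta_y)$; generator $\mathcal Lf(\eta)=\sum_{\sigma\in G}c(\eta,\sigma)(f(\sigma\eta)-f(\eta))$; reversible probability measure $\mathbf m(\eta)=\frac1Z\prod_{x\in V}\rho^{\eta_x}$ on $\Omega$. $\phi:[0,\infty)\to[0,\infty)$ is admissible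 if it is convex, twice differentiable on $(0,\infty)$, and $\Phi(a,b):=(\phi'(b)-\phi'(a))(b-a)$ is convex on $(0,\infty)^2$. $\mathcal H^\phi(f|\mathbf m)=\sum_\eta\phi(f(\eta))\mathbf m(\eta)-\phi\big(\sum_\eta f(\eta)\mathbf m(\eta)\big)$. The convex Sobolev inequality with constant $\kappa_\phi$ is: for all $f:\Omega\to(0,\infty)$, $$\kappa_\phi\,\mathcal H^\phi(f|\mathbf m)\le\frac12\sum_{\eta\in\Omega,\sigma\in G}c(\eta,\sigma)\,\Phi(f(\eta),f(\sigma\eta))\,\mathbf m(\eta).$$ Let $\phi_1(a)=a\log a-a+1$ and $\phi_\alpha(a)=\frac{1}{\alpha-1}(a^\alpha-a)-a+1$ for $\alpha\in(1,2]$. The modified logarithmic Sobolev inequality with constant $\kappa_1$ is the convex Sobolev inequality for $\phi=\phi_1$; the Beckner inequality with constant $\kappa_\alpha$ is the one for $\phi=\phi_\alpha$. *)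

theory Defs
  imports "HOL-Analysis.Analysis" "Graph_Theory.Graph_Theory"
begin

section \<open>The hardcore model on a graph\<close>

text \<open>
  A finite undirected simple graph \<open>(V, E)\<close> is given by a \<open>pair_graph\<close> \<open>G\<close>: \<open>V\<close> is \<open>pverts G\<close>,
  and \<open>E\<close> is the symmetric irreflexive relation \<open>parcs G\<close>, which contains both \<open>(x, y)\<close> and
  \<open>(y, x)\<close> for every edge.
\<close>

definition nbrs :: "'v pair_pre_digraph \<Rightarrow> 'v \<Rightarrow> 'v set" where
  "nbrs G x = {y \<in> pverts G. y \<noteq> x \<and> (y, x) \<in> parcs G}"

definition closed_nbrs :: "'v pair_pre_digraph \<Rightarrow> 'v \<Rightarrow> 'v set" where
  "closed_nbrs G x = nbrs G x \<union> {x}"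

definition max_degree :: "'v pair_pre_digraph \<Rightarrow> nat" where
  "max_degree G = (SUP x\<in>pverts G. card (nbrs G x))"

text \<open>
  Configurations are extensional functions (\<open>undefined\<close> outside \<open>V\<close>), so that they correspond
  bijectively to maps \<open>V \<rightarrow> {0, 1}\<close>. They are integer-valued so that \<open>\<eta> - \<delta>\<^sub>x\<close> is a true difference.
\<close>

definition configs :: "'v pair_pre_digraph \<Rightarrow> ('v \<Rightarrow> int) set" where
  "configs G = {\<eta> \<in> pverts G \<rightarrow>\<^sub>E {0, 1}. \<forall>(x, y) \<in> parcs G. \<eta> x * \<eta> y = 0}"

definition delta :: "'v \<Rightarrow> 'v \<Rightarrow> int" where
  "delta x y = (if y = x then 1 else 0)"

definition plus_delta :: "'v pair_pre_digraph \<Rightarrow> 'v \<Rightarrow> ('v \<Rightarrow> int) \<Rightarrow> ('v \<Rightarrow> int)" where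
  "plus_delta G x \<eta> = (\<lambda>y\<in>pverts G. \<eta> y + delta x y)"

definition minus_delta :: "'v pair_pre_digraph \<Rightarrow> 'v \<Rightarrow> ('v \<Rightarrow> int) \<Rightarrow> ('v \<Rightarrow> int)" where
  "minus_delta G x \<eta> = (\<lambda>y\<in>pverts G. \<eta> y - delta x y)"

text \<open>
  A move \<open>\<gamma>\<^sub>x\<^sup>+\<close> or \<open>\<gamma>\<^sub>x\<^sup>-\<close> is represented by its label. Distinct labels with \<open>x \<in> V\<close> act as
  distinct maps on the configuration space, so summing over labels is summing over the maps.
\<close>

datatype 'v move = Plus 'v | Minus 'v

definition moves :: "'v pair_pre_digraph \<Rightarrow> 'v move set" where
  "moves G = Plus ` pverts G \<union> Minus ` pverts G"

fun act :: "'v pair_pre_digraph \<Rightarrow> 'v move \<Rightarrow> ('v \<Rightarrow> int) \<Rightarrow> ('v \<Rightarrow> int)" where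
  "act G (Plus x) \<eta> = (if plus_delta G x \<eta> \<in> configs G then plus_delta G x \<eta> else \<eta>)"
| "act G (Minus x) \<eta> = (if minus_delta G x \<eta> \<in> configs G then minus_delta G x \<eta> else \<eta>)"

fun rate :: "'v pair_pre_digraph \<Rightarrow> real \<Rightarrow> ('v \<Rightarrow> int) \<Rightarrow> 'v move \<Rightarrow> real" where
  "rate G \<rho> \<eta> (Minus x) = of_int (\<eta> x)"
| "rate G \<rho> \<eta> (Plus x) = \<rho> * (\<Prod>y\<in>closed_nbrs G x. 1 - of_int (\<eta> y))"

definition partition_fun :: "'v pair_pre_digraph \<Rightarrow> real \<Rightarrow> real" where
  "partition_fun G \<rho> = (\<Sum>\<eta>\<in>configs G. \<Prod>x\<in>pverts G. \<rho> powi \<eta> x)"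

definition hc_measure :: "'v pair_pre_digraph \<Rightarrow> real \<Rightarrow> ('v \<Rightarrow> int) \<Rightarrow> real" where
  "hc_measure G \<rho> \<eta> = 1 / partition_fun G \<rho> * (\<Prod>x\<in>pverts G. \<rho> powi \<eta> x)"


section \<open>Convex Sobolev inequalities\<close>

definition Phi :: "(real \<Rightarrow> real) \<Rightarrow> real \<Rightarrow> real \<Rightarrow> real" where
  "Phi \<phi> a b = (deriv \<phi> b - deriv \<phi> a) * (b - a)"

text \<open>
  A function \<open>[0, \<infinity>) \<rightarrow> [0, \<infinity>)\<close> is represented by a total function on the reals; its values at
  negative arguments are irrelevant in everything below.
\<close>

definition admissible :: "(real \<Rightarrow> real) \<Rightarrow> bool" where
  "admissible \<phi> \<longleftrightarrow>
     (\<forall>a\<ge>0. 0 \<le> \<phi> a) \<and>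
     convex_on {0..} \<phi> \<and>
     (\<forall>a>0. \<phi> differentiable (at a) \<and> deriv \<phi> differentiable (at a)) \<and>
     convex_on ({0<..} \<times> {0<..}) (\<lambda>(a, b). Phi \<phi> a b)"

definition phi_entropy ::
  "'v pair_pre_digraph \<Rightarrow> real \<Rightarrow> (real \<Rightarrow> real) \<Rightarrow> (('v \<Rightarrow> int) \<Rightarrow> real) \<Rightarrow> real" where
  "phi_entropy G \<rho> \<phi> f =
     (\<Sum>\<eta>\<in>configs G. \<phi> (f \<eta>) * hc_measure G \<rho> \<eta>)
     - \<phi> (\<Sum>\<eta>\<in>configs G. f \<eta> * hc_measure G \<rho> \<eta>)"

definition convex_sobolev :: "'v pair_pre_digraph \<Rightarrow> real \<Rightarrow> (real \<Rightarrow> real) \<Rightarrow> real \<Rightarrow> bool" where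
  "convex_sobolev G \<rho> \<phi> k \<longleftrightarrow>
     (\<forall>f :: ('v \<Rightarrow> int) \<Rightarrow> real. (\<forall>\<eta>\<in>configs G. 0 < f \<eta>) \<longrightarrow>
        k * phi_entropy G \<rho> \<phi> f
        \<le> 1 / 2 * (\<Sum>\<eta>\<in>configs G. \<Sum>\<sigma>\<in>moves G.
              rate G \<rho> \<eta> \<sigma> * Phi \<phi> (f \<eta>) (f (act G \<sigma> \<eta>)) * hc_measure G \<rho> \<eta>))"

text \<open>Since \<open>ln 0 = 0\<close>, the first formula gives the usual value \<open>1\<close> at \<open>0\<close>.\<close>

definition phi_log :: "real \<Rightarrow> real" where
  "phi_log a = a * ln a - a + 1"

definition phi_power :: "real \<Rightarrow> real \<Rightarrow> real" where
  "phi_power \<alpha> a = 1 / (\<alpha> - 1) * (a powr \<alpha> - a) - a + 1"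

definition modified_log_sobolev :: "'v pair_pre_digraph \<Rightarrow> real \<Rightarrow> real \<Rightarrow> bool" where
  "modified_log_sobolev G \<rho> k \<longleftrightarrow> convex_sobolev G \<rho> phi_log k"

definition beckner :: "'v pair_pre_digraph \<Rightarrow> real \<Rightarrow> real \<Rightarrow> real \<Rightarrow> bool" where
  "beckner G \<rho> \<alpha> k \<longleftrightarrow> convex_sobolev G \<rho> (phi_power \<alpha>) k"

end

theory Submission
  imports Defs
begin

text \<open>
  Let \<open>H\<close> be the entropy and \<open>F\<close> the right-hand side of the convex Sobolev inequality. Along the
  Glauber dynamics \<open>f' = L f\<close> one has \<open>H' = - F\<close>. A coupling of the dynamics started from the two ends
  of an edge \<open>(\<eta>, \<eta> + \<delta>\<^sub>x)\<close>, combined with convexity of \<open>\<Phi>\<close>, gives \<open>F' \<le> - K F\<close>: all terms cancel by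
  reversibility and symmetry except those in which the two copies coalesce. The coalescing moves
  happen at total rate at least \<open>\<kappa>\<close>, and contribute \<open>- \<Phi>\<close> each for a general \<open>\<phi>\<close>, with an additional
  gain for the logarithmic and the power entropies. Finally, instead of integrating
  \<open>(F - K H)' \<le> 0\<close> along the semigroup, \<open>F - k H\<close> with \<open>k < K\<close> is minimised over a compact box of functions.
\<close>

section \<open>Convex entropies and their dissipation\<close>

definition dissipation :: "(real \<Rightarrow> real) \<Rightarrow> real \<Rightarrow> real \<Rightarrow> real" where
  "dissipation p a b = (p b - p a) * (b - a)"

text \<open>
  If \<open>q\<close> is the derivative of \<open>p\<close>, then \<open>dissipation' p q a b u v\<close> is the derivative of
  \<open>dissipation p\<close> at \<open>(a, b)\<close> in the direction \<open>(u, v)\<close>.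
\<close>

definition dissipation' ::
  "(real \<Rightarrow> real) \<Rightarrow> (real \<Rightarrow> real) \<Rightarrow> real \<Rightarrow> real \<Rightarrow> real \<Rightarrow> real \<Rightarrow> real" where
  "dissipation' p q a b u v = (q b * v - q a * u) * (b - a) + (p b - p a) * (v - u)"

text \<open>\<open>p\<close> and \<open>q\<close> stand for the first and second derivatives of
  \<open>\<phi>\<close>. Convexity is kept as tangent inequalities, the form in which it is applied
  below; explicit derivatives can then be supplied for the logarithm and the powers.\<close>

locale convex_entropy =
  fixes \<phi> p q :: "real \<Rightarrow> real"
  assumes phi_deriv: "0 < a \<Longrightarrow> (\<phi> has_real_derivative p a) (at a)"
    and p_deriv: "0 < a \<Longrightarrow> (p has_real_derivative q a) (at a)"
    and phi_tangent: "0 < a \<Longrightarrow> 0 < b \<Longrightarrow> p a * (b - a) \<le> \<phi> b - \<phi> a"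
    and dissipation_tangent: "0 < a \<Longrightarrow> 0 < b \<Longrightarrow> 0 < c \<Longrightarrow> 0 < d \<Longrightarrow>
      dissipation' p q a b (c - a) (d - b) \<le> dissipation p c d - dissipation p a b"
begin

abbreviation diss :: "real \<Rightarrow> real \<Rightarrow> real" where
  "diss \<equiv> dissipation p"

abbreviation diss' :: "real \<Rightarrow> real \<Rightarrow> real \<Rightarrow> real \<Rightarrow> real" where
  "diss' \<equiv> dissipation' p q"

lemma diss_commute: "diss a b = diss b a"
  by (simp add: dissipation_def algebra_simps)

lemma diss_same [simp]: "diss a a = 0"
  by (simp add: dissipation_def)

lemma diss_nonneg: "0 < a \<Longrightarrow> 0 < b \<Longrightarrow> 0 \<le> diss a b"
  using phi_tangent[of a b] phi_tangent[of b a] by (simp add: dissipation_def algebra_simps)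

lemma diss'_add: "diss' a b (u + u') (v + v') = diss' a b u v + diss' a b u' v'"
  by (simp add: dissipation'_def algebra_simps)

lemma diss'_sum: "diss' a b (\<Sum>i\<in>A. u i) (\<Sum>i\<in>A. v i) = (\<Sum>i\<in>A. diss' a b (u i) (v i))"
  by (induction A rule: infinite_finite_induct) (simp_all add: diss'_add, simp_all add: dissipation'_def)

lemma diss_has_derivative:
  assumes "0 < a" "0 < b"
  shows "((\<lambda>s. diss (a + s * u) (b + s * v)) has_real_derivative diss' a b u v) (at 0)"
proof -
  have *: "((\<lambda>s. p (c + s * w)) has_real_derivative q c * w) (at 0)" if "0 < c" for c w
    by (rule DERIV_chain2[where g = "\<lambda>s. c + s * w"]) (use p_deriv[OF that] in \<open>auto intro!: derivative_eq_intros\<close>)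
  show ?thesis
    unfolding dissipation_def dissipation'_def
    by (rule derivative_eq_intros *[OF assms(1)] *[OF assms(2)] refl | simp)+
qed

lemma p_eq_deriv: "0 < a \<Longrightarrow> p a = deriv \<phi> a"
  using DERIV_imp_deriv[OF phi_deriv] by simp

lemma Phi_eq_dissipation: "0 < a \<Longrightarrow> 0 < b \<Longrightarrow> Phi \<phi> a b = diss a b"
  by (simp add: Phi_def dissipation_def p_eq_deriv)

text \<open>The direction \<open>(b - a, 0)\<close> carries \<open>(a, b)\<close> to
  \<open>(b, b)\<close>, and \<open>(0, a - b)\<close> carries it to \<open>(a, a)\<close>. The
  exact value keeps the terms in \<open>q\<close>, the source of the extra gain for the logarithmic
  and power entropies.\<close>

lemma coalescence_eq:
  "r * diss' a b (b - a) 0 + s * diss' a b 0 (a - b)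
    = - ((r + s) * diss a b + (r * q a + s * q b) * (b - a)\<^sup>2)"
  by (simp add: dissipation_def dissipation'_def power2_eq_square algebra_simps)

text \<open>Both end points are diagonal, where \<open>diss\<close> vanishes, so the tangent
  inequality gives \<open>- diss a b\<close> for each direction.\<close>

lemma coalescence_le:
  assumes "0 < a" "0 < b" "0 \<le> r" "0 \<le> s"
  shows "r * diss' a b (b - a) 0 + s * diss' a b 0 (a - b) \<le> - ((r + s) * diss a b)"
proof -
  have A: "diss' a b (b - a) 0 \<le> - diss a b" and B: "diss' a b 0 (a - b) \<le> - diss a b"
    using dissipation_tangent[of a b b b] dissipation_tangent[of a b a a] assms by auto
  show ?thesis
    using mult_left_mono[OF A assms(3)] mult_left_mono[OF B assms(4)] by (simp add: algebra_simps)
qed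

end

section \<open>Scalar inequalities for the logarithm and the powers\<close>

text \<open>The tangent inequality for the dissipation of \<open>ln\<close>. With
  \<open>r = a * d / (b * c)\<close>, left side minus right side is exactly
  \<open>c * (1 - r + ln r) + d * (1 - 1 / r - ln r)\<close>, and both terms are nonpositive since
  \<open>ln x \<le> x - 1\<close>.\<close>

lemma ln_diss_gradient:
  fixes a b c d :: real
  assumes "0 < a" "0 < b" "0 < c" "0 < d"
  shows "((1 / b) * (d - b) - (1 / a) * (c - a)) * (b - a) + (ln b - ln a) * ((d - b) - (c - a))
    \<le> (ln d - ln c) * (d - c) - (ln b - ln a) * (b - a)"
proof -
  define r where "r = a * d / (b * c)"
  have r: "0 < r" using assms by (simp add: r_def)
  have "ln r = ln a + ln d - ln b - ln c"
    using assms by (simp add: r_def ln_div ln_mult)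
  moreover have "c * (1 - r + ln r) \<le> 0"
    using ln_le_minus_one[OF r] assms by (simp add: mult_le_0_iff)
  moreover have "d * (1 - 1 / r - ln r) \<le> 0"
    using ln_le_minus_one[of "1 / r"] r assms by (simp add: mult_le_0_iff ln_div)
  ultimately have "c - c * r + d - d * (1 / r) + (c - d) * (ln a + ln d - ln b - ln c) \<le> 0"
    by (simp add: left_diff_distrib right_diff_distrib distrib_left distrib_right)
  moreover have "c * r = a * d / b" "d * (1 / r) = b * c / a"
    using assms by (simp_all add: r_def)
  ultimately have "c - a * d / b + d - b * c / a + (c - d) * (ln a + ln d - ln b - ln c) \<le> 0"
    by simp
  moreover have "((1 / b) * (d - b) - (1 / a) * (c - a)) * (b - a) = d - a * d / b - b * c / a + c"
    using assms by (simp add: field_simps)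
  ultimately show ?thesis by (simp add: algebra_simps)
qed

text \<open>The trapezoidal rule overestimates the integral of the convex function
  \<open>1 / t\<close> between \<open>a\<close> and \<open>b\<close>. This yields the gain
  \<open>2 * \<kappa>bar\<close> in the logarithmic case.\<close>

lemma ln_diff_mult_le:
  fixes a b :: real
  assumes "0 < a" "0 < b"
  shows "2 * ((ln b - ln a) * (b - a)) \<le> (1 / a + 1 / b) * (b - a)\<^sup>2"
proof -
  have main: "2 * (ln b - ln a) \<le> (1 / a + 1 / b) * (b - a)" if "0 < a" "a \<le> b" for a b :: real
  proof -
    \<comment> \<open>Twice the trapezoidal error on the interval from \<open>a\<close> to
      \<open>t\<close>; it vanishes at \<open>t = a\<close>.\<close>
    define g where "g t = (1 / a + 1 / t) * (t - a) - 2 * (ln t - ln a)" for t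
    have "g a \<le> g b"
    proof (rule DERIV_nonneg_imp_nondecreasing[OF that(2)])
      fix t assume t: "a \<le> t" "t \<le> b"
      have "(g has_real_derivative (t - a)\<^sup>2 / (a * t\<^sup>2)) (at t)"
        unfolding g_def using t that
        by (auto intro!: derivative_eq_intros simp: field_simps power2_eq_square)
      then show "\<exists>y. (g has_real_derivative y) (at t) \<and> 0 \<le> y"
        using t that by (intro exI conjI) auto
    qed
    then show ?thesis by (simp add: g_def)
  qed
  show ?thesis
  proof (cases "a \<le> b")
    case True
    then show ?thesis
      using mult_right_mono[OF main[OF assms(1) True], of "b - a"] by (simp add: power2_eq_square mult_ac)
  next
    case False
    then have "2 * (ln a - ln b) * (a - b) \<le> (1 / b + 1 / a) * (a - b) * (a - b)"
      by (intro mult_right_mono main assms) auto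
    moreover have "2 * ((ln b - ln a) * (b - a)) = 2 * (ln a - ln b) * (a - b)"
      by (simp add: algebra_simps)
    moreover have "(1 / a + 1 / b) * (b - a)\<^sup>2 = (1 / b + 1 / a) * (a - b) * (a - b)"
      unfolding power2_commute[of b a] by (simp add: power2_eq_square mult.assoc add.commute)
    ultimately show ?thesis by simp
  qed
qed

text \<open>
  For \<open>t = a / b\<close> and \<open>\<gamma> = 1 - \<beta>\<close>, this is what makes the Hessian determinant of
  \<open>(b powr \<beta> - a powr \<beta>) * (b - a)\<close> nonnegative.
\<close>

lemma powr_add_inverse_le:
  fixes t \<gamma> :: real
  assumes "0 < t" "0 \<le> \<gamma>" "\<gamma> \<le> 1"
  shows "t powr \<gamma> + t powr - \<gamma> - 2 \<le> \<gamma> * (t + 1 / t - 2)"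
proof -
  \<comment> \<open>The tangent at \<open>1\<close> to the concave function
    \<open>u powr \<gamma>\<close>, as a weighted arithmetic-geometric mean inequality for
    \<open>u\<close> and \<open>1\<close>; it is then added up at \<open>t\<close> and
    \<open>1 / t\<close>.\<close>
  have bernoulli: "u powr \<gamma> \<le> 1 + \<gamma> * (u - 1)" if "0 < u" for u :: real
    using Youngs_inequality_0[of \<gamma> "1 - \<gamma>" u 1] that assms by (simp add: algebra_simps)
  show ?thesis
    using bernoulli[OF assms(1)] bernoulli[of "1 / t"] assms
    by (simp add: powr_minus_divide powr_divide algebra_simps)
qed

text \<open>With \<open>\<gamma> = 1 - \<beta>\<close> and \<open>\<beta> > 0\<close>, the factors
  on the right are the pure second derivatives of
  \<open>(b powr \<beta> - a powr \<beta>) * (b - a) / \<beta>\<close> in \<open>b\<close> and in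
  \<open>a\<close>; the left side is the square of the mixed one. Dividing by \<open>x * y\<close>
  leaves an inequality in \<open>a / b\<close>.\<close>

lemma powr_hessian_det:
  fixes a b \<gamma> :: real
  assumes "0 < a" "0 < b" "0 \<le> \<gamma>" "\<gamma> \<le> 1"
  shows "(a powr - \<gamma> + b powr - \<gamma>)\<^sup>2
    \<le> (2 * b powr - \<gamma> - \<gamma> * b powr (- \<gamma> - 1) * (b - a))
      * (2 * a powr - \<gamma> + \<gamma> * a powr (- \<gamma> - 1) * (b - a))"
proof -
  define x y where "x = a powr - \<gamma>" and "y = b powr - \<gamma>"
  have xy: "0 < x" "0 < y" using assms by (auto simp: x_def y_def)
  have "(a / b) powr \<gamma> = y / x" "(a / b) powr - \<gamma> = x / y"
    using assms by (simp_all add: x_def y_def powr_divide powr_minus field_simps)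
  then have "y / x + x / y - 2 \<le> \<gamma> * (a / b + b / a - 2)"
    using powr_add_inverse_le[of "a / b" \<gamma>] assms by simp
  \<comment> \<open>The factor \<open>2 - \<gamma>\<close>, at least \<open>1\<close>, is the one
    that expanding the product of the two pure second derivatives produces.\<close>
  also have "\<dots> \<le> (2 - \<gamma>) * (\<gamma> * (a / b + b / a - 2))"
  proof -
    have "a / b + b / a - 2 = (a - b)\<^sup>2 / (a * b)"
      using assms by (simp add: field_simps power2_eq_square)
    then have "0 \<le> a / b + b / a - 2" using assms by simp
    then have "0 \<le> \<gamma> * (a / b + b / a - 2)" using assms by simp
    then show ?thesis using mult_right_mono[of 1 "2 - \<gamma>"] assms by simp
  qed
  finally have "x * y * (y / x + x / y + 2) \<le> x * y * (4 + (2 - \<gamma>) * (\<gamma> * (a / b + b / a - 2)))"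
    using xy by (intro mult_left_mono) auto
  also have "x * y * (y / x + x / y + 2) = (x + y)\<^sup>2"
    using xy by (simp add: field_simps power2_eq_square)
  also have "x * y * (4 + (2 - \<gamma>) * (\<gamma> * (a / b + b / a - 2)))
      = (2 * y - \<gamma> * (y / b) * (b - a)) * (2 * x + \<gamma> * (x / a) * (b - a))"
    using assms by (simp add: field_simps)
  finally show ?thesis
    using assms by (simp add: x_def y_def powr_diff)
qed

lemma quadratic_form_nonneg:
  fixes A B C u v :: real
  assumes "0 < A" "C\<^sup>2 \<le> A * B"
  shows "0 \<le> A * v\<^sup>2 + B * u\<^sup>2 - 2 * C * u * v"
proof -
  have "A * (A * v\<^sup>2 + B * u\<^sup>2 - 2 * C * u * v) = (A * v - C * u)\<^sup>2 + (A * B - C\<^sup>2) * u\<^sup>2"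
    by (simp add: power2_eq_square algebra_simps)
  also have "0 \<le> \<dots>" using assms by simp
  finally show ?thesis using assms(1) by (simp add: zero_le_mult_iff)
qed

text \<open>The dissipation is restricted to the segment from \<open>(a, b)\<close> to
  \<open>(c, d)\<close>; its second derivative there is a Hessian form, nonnegative by
  \<open>powr_hessian_det\<close>. Dividing by \<open>\<beta>\<close> makes
  \<open>t powr (\<beta> - 1)\<close> the derivative of \<open>P\<close>.\<close>

lemma powr_dissipation_tangent:
  fixes a b c d \<beta> :: real
  assumes pos: "0 < a" "0 < b" "0 < c" "0 < d" and \<beta>: "0 < \<beta>" "\<beta> \<le> 1"
  defines "P \<equiv> \<lambda>t. t powr \<beta> / \<beta>"
  shows "dissipation' P (\<lambda>t. t powr (\<beta> - 1)) a b (c - a) (d - b)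
    \<le> dissipation P c d - dissipation P a b"
proof -
  define u v where "u = c - a" and "v = d - b"
  define x y where "x t = a + t * u" and "y t = b + t * v" for t
  have conv: "0 < w + t * (z - w)" if "0 < w" "0 < z" "t \<in> {0..1}" for w z t :: real
  proof -
    have "w + t * (z - w) = (1 - t) * w + t * z" by (simp add: algebra_simps)
    also have "0 < \<dots>"
      using that by (cases "t = 0") (auto intro!: add_nonneg_pos)
    finally show ?thesis .
  qed
  have xy: "0 < x t" "0 < y t" if "t \<in> {0..1}" for t
    using conv pos that by (auto simp: x_def y_def u_def v_def)
  have dx: "((\<lambda>t. x t powr s) has_real_derivative s * x t powr (s - 1) * u) (at t)"
    and dy: "((\<lambda>t. y t powr s) has_real_derivative s * y t powr (s - 1) * v) (at t)"
    if "t \<in> {0..1}" for s t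
    using xy[OF that] unfolding x_def y_def by (auto intro!: derivative_eq_intros)
  have dP: "((\<lambda>t. P (x t)) has_real_derivative x t powr (\<beta> - 1) * u) (at t)"
    "((\<lambda>t. P (y t)) has_real_derivative y t powr (\<beta> - 1) * v) (at t)"
    if "t \<in> {0..1}" for t
    using DERIV_cdivide[OF dx[OF that], of \<beta> \<beta>] DERIV_cdivide[OF dy[OF that], of \<beta> \<beta>] \<beta>
    by (simp_all add: P_def)
  have dyx: "((\<lambda>t. y t - x t) has_real_derivative v - u) (at t)" for t
    unfolding x_def y_def by (auto intro!: derivative_eq_intros)
  define g where "g t = dissipation P (x t) (y t)" for t
  define g' where "g' t = dissipation' P (\<lambda>t. t powr (\<beta> - 1)) (x t) (y t) u v" for t
  define g'' where "g'' t = ((\<beta> - 1) * y t powr (\<beta> - 2) * v * v - (\<beta> - 1) * x t powr (\<beta> - 2) * u * u) * (y t - x t)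
     + 2 * (y t powr (\<beta> - 1) * v - x t powr (\<beta> - 1) * u) * (v - u)" for t
  have "g' 0 * (1 - 0) \<le> g 1 - g 0"
  proof (rule f''_imp_f'[where C = "{0..1}" and f = g and f' = g' and f'' = g''])
    fix t :: real assume t: "t \<in> {0..1}"
    show "(g has_real_derivative g' t) (at t)"
      unfolding g_def g'_def dissipation_def dissipation'_def
      by (rule derivative_eq_intros dP[OF t] dyx refl)+ simp
    have dQ: "((\<lambda>t. x t powr (\<beta> - 1)) has_real_derivative (\<beta> - 1) * x t powr (\<beta> - 2) * u) (at t)"
      "((\<lambda>t. y t powr (\<beta> - 1)) has_real_derivative (\<beta> - 1) * y t powr (\<beta> - 2) * v) (at t)"
      using dx[OF t, of "\<beta> - 1"] dy[OF t, of "\<beta> - 1"] by (simp_all add: algebra_simps)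
    show "(g' has_real_derivative g'' t) (at t)"
      unfolding g'_def dissipation'_def
      by (rule DERIV_cong, (rule dQ dP[OF t] dyx DERIV_cmult_right DERIV_add DERIV_mult DERIV_diff)+)
        (simp add: g''_def algebra_simps)
    \<comment> \<open>\<open>A\<close>, \<open>B\<close> and \<open>- C\<close> below are the second
      derivatives of the dissipation in \<open>y\<close>, in \<open>x\<close> and mixed, so
      \<open>g'' t\<close> is the Hessian form in direction \<open>(u, v)\<close>.\<close>
    define \<gamma> where "\<gamma> = 1 - \<beta>"
    define A B C where "A = 2 * y t powr - \<gamma> - \<gamma> * y t powr (- \<gamma> - 1) * (y t - x t)"
      and "B = 2 * x t powr - \<gamma> + \<gamma> * x t powr (- \<gamma> - 1) * (y t - x t)"
      and "C = x t powr - \<gamma> + y t powr - \<gamma>"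
    have A: "A = y t powr (- \<gamma> - 1) * ((2 - \<gamma>) * y t + \<gamma> * x t)"
    proof -
      have "y t powr - \<gamma> = y t powr (- \<gamma> - 1) * y t"
        using xy[OF t] by (simp add: powr_diff)
      then show ?thesis by (simp add: A_def algebra_simps)
    qed
    have "0 < A"
      unfolding A using xy[OF t] \<beta> by (intro mult_pos_pos add_pos_nonneg) (auto simp: \<gamma>_def)
    moreover have "C\<^sup>2 \<le> A * B"
      unfolding A_def B_def C_def using xy[OF t] \<beta> by (intro powr_hessian_det) (auto simp: \<gamma>_def)
    ultimately have "0 \<le> A * v\<^sup>2 + B * u\<^sup>2 - 2 * C * u * v"
      by (rule quadratic_form_nonneg)
    also have "\<dots> = g'' t"
      by (simp add: A_def B_def C_def g''_def \<gamma>_def power2_eq_square algebra_simps)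
    finally show "0 \<le> g'' t" .
  qed auto
  then show ?thesis
    by (simp add: g_def g'_def x_def y_def u_def v_def)
qed

text \<open>Write \<open>t powr (\<alpha> - 1)\<close> as \<open>t powr (\<alpha> - 2) * t\<close>
  and use that \<open>t powr (\<alpha> - 2)\<close> is nonincreasing for
  \<open>\<alpha> \<le> 2\<close>.\<close>

lemma powr_dissipation_le:
  fixes a b \<alpha> :: real
  assumes "0 < a" "0 < b" "\<alpha> \<le> 2"
  shows "(b powr (\<alpha> - 1) - a powr (\<alpha> - 1)) * (b - a) \<le> a powr (\<alpha> - 2) * (b - a)\<^sup>2"
proof -
  have e: "t powr (\<alpha> - 1) = t powr (\<alpha> - 2) * t" if "0 < t" for t :: real
    using that powr_add[of t "\<alpha> - 2" 1] by simp
  have "(b powr (\<alpha> - 2) - a powr (\<alpha> - 2)) * (b - a) \<le> 0"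
    using powr_mono2'[of "\<alpha> - 2" a b] powr_mono2'[of "\<alpha> - 2" b a] assms
    by (cases "a \<le> b") (auto simp: mult_le_0_iff)
  then have "b * ((b powr (\<alpha> - 2) - a powr (\<alpha> - 2)) * (b - a)) \<le> 0"
    using assms by (simp add: mult_le_0_iff)
  then show ?thesis
    unfolding e[OF assms(1)] e[OF assms(2)] by (simp add: power2_eq_square algebra_simps)
qed

section \<open>The entropies of the theorem satisfy the tangent inequalities\<close>

text \<open>The second tangent inequality comes from convexity of \<open>Phi\<close> along the line
  through \<open>(a, b)\<close> and \<open>(c, d)\<close>, so derivatives in one variable
  suffice.\<close>

lemma convex_entropy_admissible:
  assumes "admissible \<phi>"
  shows "convex_entropy \<phi> (deriv \<phi>) (deriv (deriv \<phi>))"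
proof
  let ?p = "deriv \<phi>" and ?q = "deriv (deriv \<phi>)"
  have conv: "convex_on {0..} \<phi>"
    and diff: "\<And>a. 0 < a \<Longrightarrow> \<phi> differentiable (at a)" "\<And>a. 0 < a \<Longrightarrow> ?p differentiable (at a)"
    using assms by (auto simp: admissible_def)
  show d1: "(\<phi> has_real_derivative ?p a) (at a)" if "0 < a" for a
    using diff(1)[OF that] by (simp add: DERIV_deriv_iff_real_differentiable)
  show d2: "(?p has_real_derivative ?q a) (at a)" if "0 < a" for a
    using diff(2)[OF that] by (simp add: DERIV_deriv_iff_real_differentiable)
  show "?p a * (b - a) \<le> \<phi> b - \<phi> a" if "0 < a" "0 < b" for a b
  proof (rule convex_on_imp_above_tangent[where A = "{0<..}"])
    show "convex_on {0<..} \<phi>"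
      by (rule convex_on_subset[OF conv]) auto
    show "(\<phi> has_real_derivative ?p a) (at a within {0<..})"
      using d1[OF that(1)] by (rule has_field_derivative_at_within)
  qed (use that in \<open>simp_all add: interior_open\<close>)
next
  let ?p = "deriv \<phi>" and ?q = "deriv (deriv \<phi>)"
  have cPhi: "convex_on ({0<..} \<times> {0<..}) (\<lambda>(a, b). Phi \<phi> a b)"
    and d2: "\<And>a. 0 < a \<Longrightarrow> (?p has_real_derivative ?q a) (at a)"
    using assms by (auto simp: admissible_def DERIV_deriv_iff_real_differentiable)
  fix a b c d :: real assume pos: "0 < a" "0 < b" "0 < c" "0 < d"
  \<comment> \<open>The open set of parameters for which the line stays in the positive quadrant;
    \<open>0\<close> is an interior point of it, as the tangent inequality at \<open>0\<close>
    requires.\<close>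
  define T where "T = {t :: real. 0 < a + t * (c - a) \<and> 0 < b + t * (d - b)}"
  have T: "T = (\<lambda>t. a + t * (c - a)) -` {0<..} \<inter> (\<lambda>t. b + t * (d - b)) -` {0<..}"
    by (auto simp: T_def)
  have "open T"
    unfolding T by (intro open_Int open_vimage open_greaterThan continuous_intros)
  have T01: "0 \<in> T" "1 \<in> T" using pos by (auto simp: T_def)
  define g where "g t = dissipation ?p (a + t * (c - a)) (b + t * (d - b))" for t
  have "convex T"
    unfolding T_def
  proof (rule convexI, clarsimp)
    fix s t m n :: real
    assume *: "0 < a + s * (c - a)" "0 < b + s * (d - b)" "0 < a + t * (c - a)" "0 < b + t * (d - b)"
      "0 \<le> m" "0 \<le> n" "m + n = 1"
    have mix: "0 < w + (m * s + n * t) * z" if "0 < w + s * z" "0 < w + t * z" for w z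
    proof -
      have "w + (m * s + n * t) * z = m * (w + s * z) + n * (w + t * z) + (1 - (m + n)) * w"
        by (simp add: algebra_simps)
      also have "0 < \<dots>"
        using that *(5-7) by (cases "m = 0") (auto intro!: add_pos_nonneg)
      finally show ?thesis .
    qed
    show "0 < a + (m * s + n * t) * (c - a) \<and> 0 < b + (m * s + n * t) * (d - b)"
      using mix * by blast
  qed
  have "convex_on T g"
  proof (rule convex_onI)
    fix m s t :: real assume m: "0 < m" "m < 1" and st: "s \<in> T" "t \<in> T"
    let ?z = "\<lambda>t. (a + t * (c - a), b + t * (d - b))"
    have "?z ((1 - m) *\<^sub>R s + m *\<^sub>R t) = (1 - m) *\<^sub>R ?z s + m *\<^sub>R ?z t"
      by (simp add: algebra_simps)
    moreover have "g t = (case ?z t of (a, b) \<Rightarrow> Phi \<phi> a b)" for t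
      by (simp add: g_def dissipation_def Phi_def)
    ultimately show "g ((1 - m) *\<^sub>R s + m *\<^sub>R t) \<le> (1 - m) * g s + m * g t"
      using convex_onD[OF cPhi, of m "?z s" "?z t"] m st by (simp add: T_def)
  qed (rule \<open>convex T\<close>)
  moreover have "(g has_real_derivative dissipation' ?p ?q a b (c - a) (d - b)) (at 0)"
  proof -
    have *: "((\<lambda>s. ?p (w + s * z)) has_real_derivative ?q w * z) (at 0)" if "0 < w" for w z
      by (rule DERIV_chain2[where g = "\<lambda>s. w + s * z"])
        (use d2[OF that] in \<open>auto intro!: derivative_eq_intros\<close>)
    show ?thesis
      unfolding g_def dissipation_def dissipation'_def
      by (rule derivative_eq_intros *[OF pos(1)] *[OF pos(2)] refl | simp)+
  qed
  ultimately have "dissipation' ?p ?q a b (c - a) (d - b) * (1 - 0) \<le> g 1 - g 0"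
    using T01 \<open>open T\<close> \<open>convex T\<close>
    by (intro convex_on_imp_above_tangent[where A = T])
      (auto simp: interior_open has_field_derivative_at_within convex_connected)
  then show "dissipation' ?p ?q a b (c - a) (d - b) \<le> dissipation ?p c d - dissipation ?p a b"
    by (simp add: g_def)
qed

lemma convex_entropy_log: "convex_entropy phi_log ln (\<lambda>a. 1 / a)"
proof
  show d1: "(phi_log has_real_derivative ln a) (at a)" if "0 < a" for a
    unfolding phi_log_def using that by (auto intro!: derivative_eq_intros)
  show d2: "(ln has_real_derivative 1 / a) (at a)" if "0 < a" for a :: real
    using that by (auto intro!: derivative_eq_intros)
  show "ln a * (b - a) \<le> phi_log b - phi_log a" if "0 < a" "0 < b" for a b
    by (rule f''_imp_f'[where C = "{0<..}" and f'' = "\<lambda>a. 1 / a"]) (use that d1 d2 in auto)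
qed (unfold dissipation_def dissipation'_def, rule ln_diss_gradient)

lemma convex_entropy_power:
  assumes "1 < \<alpha>" "\<alpha> \<le> 2"
  shows "convex_entropy (phi_power \<alpha>) (\<lambda>a. 1 / (\<alpha> - 1) * (\<alpha> * a powr (\<alpha> - 1) - 1) - 1)
    (\<lambda>a. \<alpha> * a powr (\<alpha> - 2))" (is "convex_entropy _ ?p ?q")
proof
  show d1: "(phi_power \<alpha> has_real_derivative ?p a) (at a)" if "0 < a" for a
    unfolding phi_power_def using that assms by (auto intro!: derivative_eq_intros)
  show d2: "(?p has_real_derivative ?q a) (at a)" if "0 < a" for a
    using that assms by (auto intro!: derivative_eq_intros)
  show "?p a * (b - a) \<le> phi_power \<alpha> b - phi_power \<alpha> a" if "0 < a" "0 < b" for a b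
    by (rule f''_imp_f'[where C = "{0<..}" and f'' = ?q]) (use that d1 d2 assms in auto)
  fix a b c d :: real assume pos: "0 < a" "0 < b" "0 < c" "0 < d"
  let ?P = "\<lambda>t. t powr (\<alpha> - 1) / (\<alpha> - 1)" and ?Q = "\<lambda>t. t powr (\<alpha> - 1 - 1)"
  \<comment> \<open>Additive constants cancel in the dissipation, so \<open>?p\<close> may be
    replaced by \<open>\<alpha>\<close> times \<open>?P\<close>.\<close>
  have "?p x - ?p y = \<alpha> * (?P x - ?P y)" for x y
    by (simp add: algebra_simps diff_divide_distrib)
  then have "dissipation ?p x y = \<alpha> * dissipation ?P x y"
    "dissipation' ?p ?q x y u v = \<alpha> * dissipation' ?P ?Q x y u v" for x y u v
    by (simp_all add: dissipation_def dissipation'_def algebra_simps)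
  moreover have "\<alpha> * dissipation' ?P ?Q a b (c - a) (d - b) \<le> \<alpha> * (dissipation ?P c d - dissipation ?P a b)"
    using assms pos by (intro mult_left_mono powr_dissipation_tangent) auto
  ultimately show "dissipation' ?p ?q a b (c - a) (d - b) \<le> dissipation ?p c d - dissipation ?p a b"
    by (simp add: right_diff_distrib)
qed

section \<open>Dynamics on a hereditary family of sets\<close>

text \<open>Configurations are represented by their sets of occupied vertices. Of independence, only
  the downward closure is kept here; adjacency enters later through a bound on
  \<open>blocked\<close>.\<close>

locale hereditary_family =
  fixes I :: "'a set set" and \<rho> :: real
  assumes finite_I: "finite I"
    and empty_in_I: "{} \<in> I"
    and subset_in_I: "S \<in> I \<Longrightarrow> T \<subseteq> S \<Longrightarrow> T \<in> I"
    and finite_in_I: "S \<in> I \<Longrightarrow> finite S"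
    and rho_pos: "0 < \<rho>"
begin

definition free :: "'a set \<Rightarrow> 'a set" where
  "free S = {x. x \<notin> S \<and> insert x S \<in> I}"

text \<open>In the hardcore model these are neighbours of \<open>x\<close>. Adding them is possible
  at \<open>S\<close> but not at \<open>insert x S\<close>, so these moves cannot be made in both
  copies of a coupling.\<close>

definition blocked :: "'a set \<Rightarrow> 'a \<Rightarrow> 'a set" where
  "blocked S x = {y \<in> free S. y \<noteq> x \<and> insert y (insert x S) \<notin> I}"

definition weight :: "'a set \<Rightarrow> real" where
  "weight S = \<rho> ^ card S / (\<Sum>T\<in>I. \<rho> ^ card T)"

definition gen :: "('a set \<Rightarrow> real) \<Rightarrow> 'a set \<Rightarrow> real" where
  "gen f S = (\<Sum>x\<in>S. f (S - {x}) - f S) + \<rho> * (\<Sum>x\<in>free S. f (insert x S) - f S)"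

lemma finite_free: "finite (free S)"
proof (rule finite_subset)
  show "free S \<subseteq> \<Union>I" by (auto simp: free_def)
qed (use finite_I finite_in_I in auto)

lemma freeD: "x \<in> free S \<Longrightarrow> S \<in> I" "x \<in> free S \<Longrightarrow> insert x S \<in> I" "x \<in> free S \<Longrightarrow> x \<notin> S"
  by (auto simp: free_def intro: subset_in_I)

lemma Diff_in_I: "S \<in> I \<Longrightarrow> S - {x} \<in> I"
  by (rule subset_in_I) auto

lemma partition_pos: "0 < (\<Sum>T\<in>I. \<rho> ^ card T)"
  using finite_I empty_in_I rho_pos by (intro sum_pos) auto

lemma weight_pos: "0 < weight S"
  using partition_pos rho_pos by (simp add: weight_def)

lemma sum_weight: "(\<Sum>S\<in>I. weight S) = 1"
  using partition_pos by (simp add: weight_def flip: sum_divide_distrib)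

lemma weight_insert: "x \<in> free S \<Longrightarrow> weight (insert x S) = \<rho> * weight S"
  using finite_in_I[OF freeD(1)] by (simp add: weight_def freeD(3))

lemma weight_remove: "S \<in> I \<Longrightarrow> x \<in> S \<Longrightarrow> \<rho> * weight (S - {x}) = weight S"
  using weight_insert[of x "S - {x}"] by (simp add: free_def insert_absorb)

section \<open>Reversibility and symmetry identities\<close>

text \<open>Detailed balance: removing \<open>x\<close> from \<open>S\<close> is the reverse of
  adding \<open>x\<close> to \<open>S - {x}\<close>, and \<open>weight_remove\<close> matches the
  weights.\<close>

lemma sum_remove_eq_sum_add:
  "(\<Sum>S\<in>I. weight S * (\<Sum>x\<in>S. h S x)) = (\<Sum>S\<in>I. weight S * (\<rho> * (\<Sum>x\<in>free S. h (insert x S) x)))"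
proof -
  have "(\<Sum>(S, x)\<in>(SIGMA S:I. S). weight S * h S x)
      = (\<Sum>(S, x)\<in>(SIGMA S:I. free S). weight S * (\<rho> * h (insert x S) x))"
    by (rule sum.reindex_bij_witness[where i = "\<lambda>(S, x). (insert x S, x)" and j = "\<lambda>(S, x). (S - {x}, x)"])
      (auto simp: free_def insert_absorb Diff_in_I weight_remove[symmetric])
  then show ?thesis
    by (simp add: sum.Sigma finite_I finite_in_I finite_free sum_distrib_left)
qed

lemma free_insert: "free (insert y S) = {x \<in> free S. x \<noteq> y \<and> insert x (insert y S) \<in> I}"
  by (auto simp: free_def intro: subset_in_I)

text \<open>Detailed balance for the moves of an edge: \<open>x\<close> is the direction of the edge
  and \<open>y\<close> the vertex removed or added at both of its ends.\<close>

lemma sum_remove_eq_sum_add_edge: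
  "(\<Sum>S\<in>I. weight S * (\<Sum>x\<in>free S. \<Sum>y\<in>S. h S x y))
     = (\<Sum>S\<in>I. weight S * (\<rho> * (\<Sum>x\<in>free S. \<Sum>y\<in>free (insert x S). h (insert y S) x y)))"
proof -
  have "(\<Sum>y\<in>free S. \<Sum>x\<in>free (insert y S). h (insert y S) x y)
      = (\<Sum>x\<in>free S. \<Sum>y\<in>free (insert x S). h (insert y S) x y)" for S
    unfolding free_insert
    by (subst sum.swap_restrict) (auto simp: finite_free insert_commute intro!: sum.cong)
  then show ?thesis
    using sum_remove_eq_sum_add[of "\<lambda>S y. \<Sum>x\<in>free S. h S x y"]
    by (subst sum.swap) simp
qed

text \<open>Among free vertices, blocking is a symmetric relation.\<close>

lemma blocked_sum_swap:
  "(\<Sum>x\<in>free S. \<Sum>y\<in>blocked S x. g y) = (\<Sum>x\<in>free S. \<Sum>y\<in>blocked S x. g x)"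
  unfolding blocked_def
  by (subst sum.swap_restrict) (auto simp: finite_free insert_commute intro!: sum.cong)

lemma free_eq_blocked_Un:
  assumes "x \<in> free S"
  shows "free S = insert x (free (insert x S) \<union> blocked S x)"
  using assms by (auto simp: free_def blocked_def insert_commute intro: subset_in_I)

end

section \<open>The coupling estimate for the energy\<close>

text \<open>The hypothesis \<open>coalescence\<close> is where the constant \<open>K\<close> is
  decided. \<open>\<rho>\<close> is the rate of adding \<open>x\<close> to \<open>S\<close>, and
  \<open>1 - \<rho> * real k\<close> is what remains of the unit rate of removing \<open>x\<close>
  after pairing with \<open>k\<close> blocked additions.\<close>

locale entropy_dissipation = hereditary_family I \<rho> + convex_entropy \<phi> p q
  for I :: "'a set set" and \<rho> :: real and \<phi> p q :: "real \<Rightarrow> real" +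
  fixes K :: real and \<Delta> :: nat
  assumes coalescence: "0 < a \<Longrightarrow> 0 < b \<Longrightarrow> k \<le> \<Delta> \<Longrightarrow>
      \<rho> * diss' a b (b - a) 0 + (1 - \<rho> * real k) * diss' a b 0 (a - b) \<le> - (K * diss a b)"
    and card_blocked_le: "x \<in> free S \<Longrightarrow> card (blocked S x) \<le> \<Delta>"
    and K_pos: "0 < K"
begin

definition edge :: "('a set \<Rightarrow> real) \<Rightarrow> 'a set \<Rightarrow> 'a \<Rightarrow> real" where
  "edge f S x = diss (f S) (f (insert x S))"

text \<open>Each edge is counted once, in the direction of addition; this absorbs the factor
  \<open>1 / 2\<close> of the convex Sobolev inequality.\<close>

definition energy :: "('a set \<Rightarrow> real) \<Rightarrow> real" where
  "energy f = (\<Sum>S\<in>I. weight S * (\<rho> * (\<Sum>x\<in>free S. edge f S x)))"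

definition mean :: "('a set \<Rightarrow> real) \<Rightarrow> real" where
  "mean f = (\<Sum>S\<in>I. weight S * f S)"

definition entropy :: "('a set \<Rightarrow> real) \<Rightarrow> real" where
  "entropy f = (\<Sum>S\<in>I. weight S * \<phi> (f S)) - \<phi> (mean f)"

lemma mean_pos:
  assumes "\<And>S. S \<in> I \<Longrightarrow> 0 < f S"
  shows "0 < mean f"
  unfolding mean_def using finite_I empty_in_I weight_pos assms by (intro sum_pos) auto

lemma energy_nonneg:
  assumes "\<And>S. S \<in> I \<Longrightarrow> 0 < f S"
  shows "0 \<le> energy f"
  unfolding energy_def edge_def
  by (intro sum_nonneg mult_nonneg_nonneg diss_nonneg assms)
    (auto dest: freeD intro: less_imp_le weight_pos rho_pos)

text \<open>
  The two copies of the dynamics started from \<open>S\<close> and \<open>insert x S\<close> are coupled as follows: moves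
  possible in both are made together; the additions of \<open>x\<close> to \<open>S\<close> are made alone; and the removal
  of \<open>x\<close> from \<open>insert x S\<close>, which has rate \<open>1\<close>, is paired with the additions to \<open>S\<close> of the
  vertices blocked by \<open>x\<close>, the remaining rate \<open>1 - \<rho> * card (blocked S x)\<close> being used alone.
\<close>

lemma diss'_gen_le:
  assumes pos: "\<And>S. S \<in> I \<Longrightarrow> 0 < f S" and x: "x \<in> free S"
  shows "diss' (f S) (f (insert x S)) (gen f S) (gen f (insert x S))
    \<le> (\<Sum>y\<in>S. edge f (S - {y}) x - edge f S x)
      + \<rho> * (\<Sum>y\<in>free (insert x S). edge f (insert y S) x - edge f S x)
      + \<rho> * (\<Sum>y\<in>blocked S x. edge f S y - edge f S x)
      - K * edge f S x"
proof -
  note S = freeD[OF x]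
  define a b where "a = f S" and "b = f (insert x S)"
  have ab: "0 < a" "0 < b" using pos S by (auto simp: a_def b_def)
  define A1 A2 A3 where "A1 = (\<Sum>y\<in>S. f (S - {y}) - a)"
    and "A2 = (\<Sum>y\<in>free (insert x S). f (insert y S) - a)"
    and "A3 = (\<Sum>y\<in>blocked S x. f (insert y S) - a)"
  define B1 B2 where "B1 = (\<Sum>y\<in>S. f (insert x (S - {y})) - b)"
    and "B2 = (\<Sum>y\<in>free (insert x S). f (insert y (insert x S)) - b)"
  have fin: "finite S" "finite (blocked S x)"
    using finite_in_I S finite_free[of S] by (auto simp: blocked_def)
  have "gen f S = A1 + \<rho> * (\<Sum>y\<in>insert x (free (insert x S) \<union> blocked S x). f (insert y S) - a)"
    unfolding gen_def A1_def a_def by (subst free_eq_blocked_Un[OF x]) simp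
  also have "(\<Sum>y\<in>insert x (free (insert x S) \<union> blocked S x). f (insert y S) - a)
      = (b - a) + (\<Sum>y\<in>free (insert x S) \<union> blocked S x. f (insert y S) - a)"
    by (subst sum.insert) (auto simp: finite_free fin b_def, auto simp: free_def blocked_def)
  also have "(\<Sum>y\<in>free (insert x S) \<union> blocked S x. f (insert y S) - a) = A2 + A3"
    unfolding A2_def A3_def
    by (subst sum.union_disjoint) (auto simp: finite_free fin, auto simp: free_def blocked_def)
  finally have gen1: "gen f S = A1 + \<rho> * ((b - a) + (A2 + A3))" .
  have "(\<Sum>y\<in>insert x S. f (insert x S - {y}) - b) = (a - b) + B1"
    unfolding B1_def using fin S
    by (subst sum.insert) (auto simp: a_def insert_Diff_if intro!: sum.cong)
  then have gen2: "gen f (insert x S) = (a - b) + (B1 + \<rho> * B2)"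
    by (simp add: gen_def B2_def b_def)
  \<comment> \<open>Linearity in the direction: each blocked addition takes a share
    \<open>\<rho>\<close> of the removal direction \<open>(0, a - b)\<close>.\<close>
  have "diss' a b (gen f S) (gen f (insert x S))
      = diss' a b A1 B1 + \<rho> * diss' a b A2 B2 + \<rho> * diss' a b A3 (\<Sum>y\<in>blocked S x. a - b)
        + (\<rho> * diss' a b (b - a) 0 + (1 - \<rho> * real (card (blocked S x))) * diss' a b 0 (a - b))"
    unfolding gen1 gen2 by (simp add: dissipation'_def algebra_simps)
  also have "\<dots> \<le> (\<Sum>y\<in>S. edge f (S - {y}) x - edge f S x)
      + \<rho> * (\<Sum>y\<in>free (insert x S). edge f (insert y S) x - edge f S x)
      + \<rho> * (\<Sum>y\<in>blocked S x. edge f S y - edge f S x)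
      + - (K * diss a b)"
  proof (intro add_mono mult_left_mono)
    show "diss' a b A1 B1 \<le> (\<Sum>y\<in>S. edge f (S - {y}) x - edge f S x)"
      unfolding A1_def B1_def diss'_sum edge_def a_def[symmetric] b_def[symmetric]
    proof (intro sum_mono dissipation_tangent ab pos)
      show "S - {y} \<in> I" for y using S Diff_in_I by auto
      show "insert x (S - {y}) \<in> I" for y by (rule subset_in_I[OF S(2)]) auto
    qed
    show "diss' a b A2 B2 \<le> (\<Sum>y\<in>free (insert x S). edge f (insert y S) x - edge f S x)"
      unfolding A2_def B2_def diss'_sum edge_def a_def[symmetric] b_def[symmetric]
        insert_commute[of x]
      by (intro sum_mono dissipation_tangent ab pos) (auto simp: free_insert dest: freeD)
    \<comment> \<open>Adding \<open>y\<close> at one end while removing \<open>x\<close> at the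
      other gives the pair \<open>(insert y S, S)\<close>: the edge of \<open>S\<close> in direction
      \<open>y\<close>, traversed backwards.\<close>
    have "diss' a b A3 (\<Sum>y\<in>blocked S x. a - b) \<le> (\<Sum>y\<in>blocked S x. diss (f (insert y S)) a - diss a b)"
      unfolding A3_def diss'_sum
      by (intro sum_mono dissipation_tangent ab pos) (auto simp: blocked_def dest: freeD)
    then show "diss' a b A3 (\<Sum>y\<in>blocked S x. a - b) \<le> (\<Sum>y\<in>blocked S x. edge f S y - edge f S x)"
      by (simp add: edge_def a_def b_def diss_commute)
    show "\<rho> * diss' a b (b - a) 0 + (1 - \<rho> * real (card (blocked S x))) * diss' a b 0 (a - b)
        \<le> - (K * diss a b)"
      by (intro coalescence ab card_blocked_le x)
  qed (use rho_pos in auto)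
  finally show ?thesis by (simp add: a_def b_def edge_def)
qed

text \<open>The left side is the derivative of \<open>energy\<close> along the flow. Common removals
  \<open>X1\<close> and common additions \<open>X2\<close> cancel by reversibility, the blocked
  moves \<open>X3\<close> by symmetry, and only the coalescence term survives.\<close>

lemma energy_derivative_le:
  assumes pos: "\<And>S. S \<in> I \<Longrightarrow> 0 < f S"
  shows "(\<Sum>S\<in>I. weight S * (\<rho> * (\<Sum>x\<in>free S. diss' (f S) (f (insert x S)) (gen f S) (gen f (insert x S)))))
    \<le> - (K * energy f)"
proof -
  define X1 where "X1 = (\<Sum>S\<in>I. weight S * (\<Sum>x\<in>free S. \<Sum>y\<in>S. edge f (S - {y}) x - edge f S x))"
  define X2 where "X2 = (\<Sum>S\<in>I. weight S * (\<rho> * (\<Sum>x\<in>free S. \<Sum>y\<in>free (insert x S). edge f (insert y S) x - edge f S x)))"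
  define X3 where "X3 = (\<Sum>S\<in>I. weight S * (\<Sum>x\<in>free S. \<Sum>y\<in>blocked S x. edge f S y - edge f S x))"
  have "X1 = (\<Sum>S\<in>I. weight S * (\<rho> * (\<Sum>x\<in>free S. \<Sum>y\<in>free (insert x S).
      edge f (insert y S - {y}) x - edge f (insert y S) x)))"
    unfolding X1_def by (rule sum_remove_eq_sum_add_edge)
  also have "\<dots> = - X2"
    unfolding X2_def sum_negf[symmetric] mult_minus_right[symmetric]
    by (intro sum.cong arg_cong2[where f = "(*)"] refl) (auto simp: free_def)
  finally have X12: "X1 + X2 = 0" by simp
  have X3: "X3 = 0"
    by (simp add: X3_def sum_subtractf blocked_sum_swap)
  have "(\<Sum>S\<in>I. weight S * (\<rho> * (\<Sum>x\<in>free S. diss' (f S) (f (insert x S)) (gen f S) (gen f (insert x S)))))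
    \<le> (\<Sum>S\<in>I. weight S * (\<rho> * (\<Sum>x\<in>free S. (\<Sum>y\<in>S. edge f (S - {y}) x - edge f S x)
      + \<rho> * (\<Sum>y\<in>free (insert x S). edge f (insert y S) x - edge f S x)
      + \<rho> * (\<Sum>y\<in>blocked S x. edge f S y - edge f S x)
      - K * edge f S x)))"
    using rho_pos weight_pos
    by (intro sum_mono mult_left_mono diss'_gen_le pos) (auto intro: less_imp_le)
  also have "\<dots> = \<rho> * (X1 + X2 + \<rho> * X3) - K * energy f"
    unfolding X1_def X2_def X3_def energy_def
    by (simp only: sum.distrib sum_subtractf distrib_left right_diff_distrib sum_distrib_left mult_ac)
  finally show ?thesis using X12 X3 by simp
qed

section \<open>Derivatives along the flow\<close>

text \<open>The Dirichlet form of the generator, obtained by applying detailed balance to the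
  removal half of \<open>gen\<close>.\<close>

lemma integration_by_parts:
  "(\<Sum>S\<in>I. weight S * (g S * gen f S))
    = - (\<Sum>S\<in>I. weight S * (\<rho> * (\<Sum>x\<in>free S. (g (insert x S) - g S) * (f (insert x S) - f S))))"
proof -
  have "(\<Sum>S\<in>I. weight S * (g S * gen f S))
     = (\<Sum>S\<in>I. weight S * (\<Sum>x\<in>S. g S * (f (S - {x}) - f S)))
       + (\<Sum>S\<in>I. weight S * (\<rho> * (\<Sum>x\<in>free S. g S * (f (insert x S) - f S))))"
    by (simp add: gen_def distrib_left sum.distrib sum_distrib_left mult_ac)
  also have "(\<Sum>S\<in>I. weight S * (\<Sum>x\<in>S. g S * (f (S - {x}) - f S)))
     = (\<Sum>S\<in>I. weight S * (\<rho> * (\<Sum>x\<in>free S. g (insert x S) * (f (insert x S - {x}) - f (insert x S)))))"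
    by (rule sum_remove_eq_sum_add)
  also have "\<dots> = (\<Sum>S\<in>I. weight S * (\<rho> * (\<Sum>x\<in>free S. g (insert x S) * (f S - f (insert x S)))))"
    by (intro sum.cong arg_cong2[where f = "(*)"] refl) (auto simp: free_def)
  finally show ?thesis
    by (simp flip: sum.distrib sum_negf distrib_left mult_minus_right)
      (simp add: algebra_simps)
qed

lemma energy_has_derivative:
  assumes pos: "\<And>S. S \<in> I \<Longrightarrow> 0 < f S"
  shows "((\<lambda>s. energy (\<lambda>S. f S + s * g S)) has_real_derivative
    (\<Sum>S\<in>I. weight S * (\<rho> * (\<Sum>x\<in>free S. diss' (f S) (f (insert x S)) (g S) (g (insert x S)))))) (at 0)"
  unfolding energy_def edge_def
  by (intro DERIV_sum DERIV_cmult diss_has_derivative pos) (auto dest: freeD)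

text \<open>The flow preserves the mean (integration by parts against \<open>1\<close>), so only the
  first term of the entropy varies; its derivative is integrated by parts against \<open>p\<close>
  composed with \<open>f\<close>.\<close>

lemma entropy_has_derivative:
  assumes pos: "\<And>S. S \<in> I \<Longrightarrow> 0 < f S"
  shows "((\<lambda>s. entropy (\<lambda>S. f S + s * gen f S)) has_real_derivative - energy f) (at 0)"
proof -
  have *: "((\<lambda>s. \<phi> (c + s * w)) has_real_derivative p c * w) (at 0)" if "0 < c" for c w
    by (rule DERIV_chain2[where g = "\<lambda>s. c + s * w"])
      (use phi_deriv[OF that] in \<open>auto intro!: derivative_eq_intros\<close>)
  have "mean (gen f) = 0"
    using integration_by_parts[of "\<lambda>_. 1" f] by (simp add: mean_def)
  then have "mean (\<lambda>S. f S + s * gen f S) = mean f" for s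
    by (simp add: mean_def distrib_left sum.distrib mult.left_commute[of _ s] flip: sum_distrib_left)
  moreover have "((\<lambda>s. (\<Sum>S\<in>I. weight S * \<phi> (f S + s * gen f S)) - \<phi> (mean f)) has_real_derivative
      (\<Sum>S\<in>I. weight S * (p (f S) * gen f S)) - 0) (at 0)"
    by (intro DERIV_diff DERIV_sum DERIV_cmult DERIV_const * pos)
  ultimately show ?thesis
    by (simp add: entropy_def integration_by_parts energy_def edge_def dissipation_def)
qed

text \<open>Without strict convexity \<open>f\<close> itself may vary, but \<open>p\<close> composed
  with \<open>f\<close> is constant, because every \<open>S\<close> is built from \<open>{}\<close>
  by additions. The tangent inequality at \<open>f S\<close> then averages to zero.\<close>

lemma entropy_nonpos_of_energy_zero:
  assumes pos: "\<And>S. S \<in> I \<Longrightarrow> 0 < f S" and zero: "energy f = 0"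
  shows "entropy f \<le> 0"
proof -
  have edge_nonneg: "0 \<le> edge f S x" if "x \<in> free S" for S x
    unfolding edge_def using that by (intro diss_nonneg pos) (auto dest: freeD)
  have "edge f S x = 0" if x: "x \<in> free S" for S x
  proof -
    have "weight S * (\<rho> * (\<Sum>x\<in>free S. edge f S x)) = 0"
      using zero freeD[OF x] finite_I unfolding energy_def
      by (subst (asm) sum_nonneg_eq_0_iff)
        (auto intro!: mult_nonneg_nonneg sum_nonneg edge_nonneg simp: less_imp_le weight_pos rho_pos)
    then have "(\<Sum>x\<in>free S. edge f S x) = 0"
      using weight_pos[of S] rho_pos by simp
    then show ?thesis
      using x edge_nonneg finite_free by (subst (asm) sum_nonneg_eq_0_iff) auto
  qed
  then have step: "p (f (insert x S)) = p (f S)" if "x \<in> free S" for x S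
    using that by (fastforce simp: edge_def dissipation_def)
  have const: "p (f S) = p (f {})" if "S \<in> I" for S
    using finite_in_I[OF that] that
  proof (induction S rule: finite_induct)
    case (insert x S)
    then have "x \<in> free S" by (auto simp: free_def)
    then show ?case using step freeD insert.IH by metis
  qed simp
  have "entropy f = (\<Sum>S\<in>I. weight S * (\<phi> (f S) - \<phi> (mean f)))"
    by (simp add: entropy_def right_diff_distrib sum_subtractf sum_weight flip: sum_distrib_right)
  also have "\<dots> \<le> (\<Sum>S\<in>I. weight S * (p (f {}) * (f S - mean f)))"
  proof (intro sum_mono mult_left_mono)
    fix S assume S: "S \<in> I"
    show "\<phi> (f S) - \<phi> (mean f) \<le> p (f {}) * (f S - mean f)"
      using phi_tangent[OF pos[OF S] mean_pos[of f]] pos const[OF S] by (simp add: algebra_simps)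
  qed (use weight_pos in \<open>auto intro: less_imp_le\<close>)
  also have "\<dots> = p (f {}) * ((\<Sum>S\<in>I. weight S * f S) - (\<Sum>S\<in>I. weight S) * mean f)"
    by (simp add: sum_distrib_left sum_distrib_right sum_subtractf algebra_simps)
  also have "\<dots> = 0"
    by (simp add: sum_weight mean_def)
  finally show ?thesis .
qed

section \<open>Minimisation over a box of functions\<close>

lemma box_minimizer:
  assumes "0 < \<epsilon>" "\<epsilon> \<le> M"
  obtains g where "\<And>S. S \<in> I \<Longrightarrow> g S \<in> {\<epsilon>..M}"
    and "\<And>h. (\<And>S. S \<in> I \<Longrightarrow> h S \<in> {\<epsilon>..M}) \<Longrightarrow> energy g - k * entropy g \<le> energy h - k * entropy h"
proof -
  \<comment> \<open>Coordinates outside \<open>I\<close> are frozen at \<open>0\<close>, so the box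
    is a product of compact sets over the whole index type.\<close>
  define B :: "('a set \<Rightarrow> real) set" where "B = PiE UNIV (\<lambda>S. if S \<in> I then {\<epsilon>..M} else {0})"
  have "compactin euclidean B"
    unfolding B_def euclidean_product_topology[symmetric] compactin_PiE by auto
  then have "compact B" by simp
  moreover have "B \<noteq> {}"
    unfolding B_def using assms by (auto simp: PiE_eq_empty_iff)
  moreover have "continuous_on B (\<lambda>f. energy f - k * entropy f)"
  proof -
    have pos: "f S \<in> {0<..}" if "f \<in> B" "S \<in> I" for f S
      using PiE_mem[OF that(1)[unfolded B_def], of S] that(2) assms by auto
    have coord: "continuous_on B (\<lambda>f. f S)" for S
      by (rule continuous_on_subset[OF continuous_on_product_coordinates]) simp
    have p: "continuous_on {0<..} p" and phi: "continuous_on {0<..} \<phi>"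
      by (rule DERIV_continuous_on[where D = q] DERIV_continuous_on[where D = p],
          simp add: p_deriv phi_deriv has_field_derivative_at_within)+
    have pS: "continuous_on B (\<lambda>f. p (f S))" and phiS: "continuous_on B (\<lambda>f. \<phi> (f S))" if "S \<in> I" for S
    proof -
      have "(\<lambda>f. f S) ` B \<subseteq> {0<..}" using pos that by blast
      then show "continuous_on B (\<lambda>f. p (f S))" "continuous_on B (\<lambda>f. \<phi> (f S))"
        by (rule continuous_on_compose2[OF p coord] continuous_on_compose2[OF phi coord])+
    qed
    have mean: "continuous_on B mean"
      unfolding mean_def by (intro continuous_intros coord)
    have "mean ` B \<subseteq> {0<..}"
      using pos mean_pos by force
    then have "continuous_on B (\<lambda>f. \<phi> (mean f))"
      by (rule continuous_on_compose2[OF phi mean])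
    then show ?thesis
      unfolding energy_def edge_def dissipation_def entropy_def
      by (intro continuous_intros coord pS phiS) (auto dest: freeD)
  qed
  ultimately obtain g where g: "g \<in> B"
    and min: "\<forall>h\<in>B. energy g - k * entropy g \<le> energy h - k * entropy h"
    by (rule continuous_attains_inf[THEN bexE])
  show thesis
  proof
    show "g S \<in> {\<epsilon>..M}" if "S \<in> I" for S
      using PiE_mem[OF g[unfolded B_def], of S] that by simp
  next
    fix h assume h: "\<And>S. S \<in> I \<Longrightarrow> h S \<in> {\<epsilon>..M}"
    define h' where "h' S = (if S \<in> I then h S else 0)" for S
    have "h' \<in> B" using h by (auto simp: h'_def B_def)
    moreover have "energy h' = energy h" "entropy h' = entropy h"
      by (auto simp: energy_def entropy_def mean_def edge_def h'_def freeD intro!: sum.cong)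
    ultimately show "energy g - k * entropy g \<le> energy h - k * entropy h"
      using min by auto
  qed
qed

text \<open>\<open>r\<close> is the total jump rate at \<open>S\<close>, and \<open>gen f S\<close>
  is a sum of differences between values in the box and \<open>f S\<close>, of total weight
  \<open>r\<close>.\<close>

lemma gen_between:
  assumes box: "\<And>S. S \<in> I \<Longrightarrow> f S \<in> {\<epsilon>..M}" and S: "S \<in> I"
  defines "r \<equiv> real (card S) + \<rho> * real (card (free S))"
  shows "r * (\<epsilon> - f S) \<le> gen f S" "gen f S \<le> r * (M - f S)"
proof -
  have box1: "f (S - {x}) \<in> {\<epsilon>..M}" for x using box Diff_in_I[OF S] by blast
  have box2: "f (insert x S) \<in> {\<epsilon>..M}" if "x \<in> free S" for x using box freeD[OF that] by blast
  show "r * (\<epsilon> - f S) \<le> gen f S" "gen f S \<le> r * (M - f S)"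
    unfolding r_def gen_def distrib_right mult.assoc using box1 box2 rho_pos
    by (auto intro!: add_mono mult_left_mono sum_bounded_below sum_bounded_above)
qed

text \<open>An Euler step short enough that \<open>s\<close> times each total jump rate is at most
  \<open>1\<close> cannot leave the box.\<close>

lemma box_invariant:
  assumes box: "\<And>S. S \<in> I \<Longrightarrow> f S \<in> {\<epsilon>..M}"
  obtains s\<^sub>0 where "0 < s\<^sub>0" "\<And>s S. 0 < s \<Longrightarrow> s \<le> s\<^sub>0 \<Longrightarrow> S \<in> I \<Longrightarrow> f S + s * gen f S \<in> {\<epsilon>..M}"
proof -
  define r where "r S = real (card S) + \<rho> * real (card (free S))" for S
  \<comment> \<open>The summand \<open>1\<close> keeps \<open>R\<close> positive even when all rates
    vanish.\<close>
  define R where "R = 1 + (\<Sum>S\<in>I. r S)"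
  have r_nonneg: "0 \<le> r S" for S using rho_pos by (simp add: r_def)
  have R: "0 < R" using r_nonneg by (simp add: R_def add_pos_nonneg sum_nonneg)
  have "f S + s * gen f S \<in> {\<epsilon>..M}" if s: "0 < s" "s \<le> 1 / R" and S: "S \<in> I" for s S
  proof -
    have "r S \<le> R" unfolding R_def
      using member_le_sum[OF S, of r] r_nonneg finite_I by auto
    then have "s * r S \<le> 1 / R * R" using s R r_nonneg by (intro mult_mono) auto
    then have sr: "s * r S \<le> 1" using R by simp
    have "s * r S * (f S - \<epsilon>) \<le> f S - \<epsilon>" "s * r S * (M - f S) \<le> M - f S"
      using mult_right_mono[OF sr, of "f S - \<epsilon>"] mult_right_mono[OF sr, of "M - f S"] box[OF S] by auto
    moreover have "s * (r S * (\<epsilon> - f S)) \<le> s * gen f S" "s * gen f S \<le> s * (r S * (M - f S))"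
      using gen_between[OF box S] s by (auto simp: r_def)
    ultimately show ?thesis by (auto simp: algebra_simps)
  qed
  with R show thesis by (intro that[of "1 / R"]) auto
qed

text \<open>
  At a minimiser of \<open>energy - k * entropy\<close> over a box, which the flow \<open>gen\<close> does not leave, the
  derivative along the flow is nonnegative; since it is at most \<open>- (K - k) * energy\<close>, the energy
  vanishes there. This replaces the usual argument via convergence to equilibrium.
\<close>

lemma entropy_le_energy_strict:
  assumes pos: "\<And>S. S \<in> I \<Longrightarrow> 0 < f S" and k: "0 < k" "k < K"
  shows "k * entropy f \<le> energy f"
proof -
  \<comment> \<open>The tightest box containing \<open>f\<close>, which makes \<open>f\<close> a
    competitor for the minimiser.\<close>
  define \<epsilon> M where "\<epsilon> = Min (f ` I)" and "M = Max (f ` I)"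
  have fbox: "f S \<in> {\<epsilon>..M}" if "S \<in> I" for S
    using that finite_I by (auto simp: \<epsilon>_def M_def)
  have eps: "0 < \<epsilon>"
    unfolding \<epsilon>_def using pos finite_I empty_in_I by (subst Min_gr_iff) auto
  have "\<epsilon> \<le> M" using fbox[OF empty_in_I] by auto
  then obtain g where gbox: "\<And>S. S \<in> I \<Longrightarrow> g S \<in> {\<epsilon>..M}"
    and min: "\<And>h. (\<And>S. S \<in> I \<Longrightarrow> h S \<in> {\<epsilon>..M}) \<Longrightarrow> energy g - k * entropy g \<le> energy h - k * entropy h"
    by (rule box_minimizer[OF eps]) blast
  have gpos: "0 < g S" if "S \<in> I" for S using gbox[OF that] eps by simp
  obtain s\<^sub>0 where s0: "0 < s\<^sub>0"
    and inv: "\<And>s S. 0 < s \<Longrightarrow> s \<le> s\<^sub>0 \<Longrightarrow> S \<in> I \<Longrightarrow> g S + s * gen g S \<in> {\<epsilon>..M}"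
    by (rule box_invariant[OF gbox]) blast+
  define D where "D = (\<lambda>s. energy (\<lambda>S. g S + s * gen g S) - k * entropy (\<lambda>S. g S + s * gen g S))"
  define l where "l = (\<Sum>S\<in>I. weight S * (\<rho> * (\<Sum>x\<in>free S.
    diss' (g S) (g (insert x S)) (gen g S) (gen g (insert x S))))) - k * - energy g"
  have D: "(D has_real_derivative l) (at 0)"
    unfolding D_def l_def
    by (intro DERIV_diff DERIV_cmult energy_has_derivative entropy_has_derivative gpos)
  \<comment> \<open>Invariance of the box is available for forward steps, so minimality yields a
    sign for \<open>l\<close> rather than \<open>l = 0\<close>.\<close>
  have "0 \<le> l"
  proof (rule ccontr)
    assume "\<not> 0 \<le> l"
    then obtain d where d: "0 < d" "\<And>h. 0 < h \<Longrightarrow> h < d \<Longrightarrow> D (0 + h) < D 0"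
      using DERIV_neg_dec_right[OF D] by auto
    define h where "h = min (d / 2) s\<^sub>0"
    have h: "0 < h" "h < d" "h \<le> s\<^sub>0" using d s0 by (auto simp: h_def)
    have "D 0 \<le> D h" unfolding D_def using min[OF inv[OF h(1,3)]] by simp
    with d(2)[OF h(1,2)] show False by simp
  qed
  moreover have "l \<le> - ((K - k) * energy g)"
    using energy_derivative_le[of g] gpos by (simp add: l_def algebra_simps)
  ultimately have "(K - k) * energy g \<le> 0" by simp
  then have "energy g = 0"
    using k energy_nonneg[of g] gpos by (simp add: mult_le_0_iff)
  moreover have "entropy g \<le> 0"
    by (rule entropy_nonpos_of_energy_zero[OF gpos \<open>energy g = 0\<close>])
  ultimately have "0 \<le> energy g - k * entropy g"
    using k by (simp add: mult_le_0_iff)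
  also have "\<dots> \<le> energy f - k * entropy f"
    by (rule min[OF fbox])
  finally show ?thesis by simp
qed

text \<open>Let \<open>k\<close> increase to \<open>K\<close>. Dividing by the entropy requires it
  to be positive; otherwise nonnegativity of the energy suffices.\<close>

theorem entropy_le_energy:
  assumes pos: "\<And>S. S \<in> I \<Longrightarrow> 0 < f S"
  shows "K * entropy f \<le> energy f"
proof (cases "0 < entropy f")
  case True
  have "K \<le> energy f / entropy f"
    by (rule dense_le_bounded[OF K_pos])
      (use entropy_le_energy_strict[OF pos] True in \<open>simp add: field_simps\<close>)
  with True show ?thesis by (simp add: field_simps)
next
  case False
  then have "K * entropy f \<le> 0" using K_pos by (simp add: mult_le_0_iff)
  also have "0 \<le> energy f" by (rule energy_nonneg[OF pos])
  finally show ?thesis .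
qed

end

section \<open>The hardcore model\<close>

definition independent_sets :: "'v pair_pre_digraph \<Rightarrow> 'v set set" where
  "independent_sets G = {S. S \<subseteq> pverts G \<and> (\<forall>(x, y)\<in>parcs G. \<not> (x \<in> S \<and> y \<in> S))}"

definition config_of :: "'v pair_pre_digraph \<Rightarrow> 'v set \<Rightarrow> 'v \<Rightarrow> int" where
  "config_of G S = (\<lambda>x\<in>pverts G. if x \<in> S then 1 else 0)"

lemma hereditary_independent_sets:
  assumes "pair_graph G" "0 < \<rho>"
  shows "hereditary_family (independent_sets G) \<rho>"
proof -
  interpret pair_graph G by fact
  show ?thesis
  proof
    show "finite (independent_sets G)"
      by (rule finite_subset[of _ "Pow (pverts G)"]) (auto simp: independent_sets_def)
    show "finite S" if "S \<in> independent_sets G" for S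
      using that by (auto simp: independent_sets_def intro: finite_subset)
    show "T \<in> independent_sets G" if "S \<in> independent_sets G" "T \<subseteq> S" for S T
      using that by (fastforce simp: independent_sets_def)
  qed (use assms in \<open>auto simp: independent_sets_def\<close>)
qed

section \<open>Dictionary between configurations and independent sets\<close>

context pair_graph begin

lemma parcsD: "(x, y) \<in> parcs G \<Longrightarrow> x \<in> pverts G \<and> y \<in> pverts G \<and> x \<noteq> y \<and> (y, x) \<in> parcs G"
  using arc_fst_in_verts[of "(x, y)"] arc_snd_in_verts[of "(x, y)"] pair_no_loops[of "(x, y)"]
    pair_sym_arcs by (auto simp: symmetric_def dest: symD)

lemma bij_betw_config_of: "bij_betw (config_of G) (independent_sets G) (configs G)"
proof (rule bij_betwI[where g = "\<lambda>\<eta>. {x \<in> pverts G. \<eta> x = 1}"])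
  show "config_of G \<in> independent_sets G \<rightarrow> configs G"
    using parcsD by (fastforce simp: independent_sets_def configs_def config_of_def)
  show "(\<lambda>\<eta>. {x \<in> pverts G. \<eta> x = 1}) \<in> configs G \<rightarrow> independent_sets G"
    by (fastforce simp: independent_sets_def configs_def)
  show "{x \<in> pverts G. config_of G S x = 1} = S" if "S \<in> independent_sets G" for S
    using that by (auto simp: independent_sets_def config_of_def)
  show "config_of G {x \<in> pverts G. \<eta> x = 1} = \<eta>" if "\<eta> \<in> configs G" for \<eta>
    using that by (force simp: configs_def config_of_def PiE_iff extensional_def)
qed

lemma config_of_in_configs: "S \<in> independent_sets G \<Longrightarrow> config_of G S \<in> configs G"
  using bij_betw_config_of by (auto simp: bij_betw_def)

lemma prod_config_of:
  assumes "S \<in> independent_sets G"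
  shows "(\<Prod>x\<in>pverts G. \<rho> powi config_of G S x) = \<rho> ^ card S"
proof -
  have "(\<Prod>x\<in>pverts G. \<rho> powi config_of G S x) = (\<Prod>x\<in>pverts G. if x \<in> S then \<rho> else 1)"
    by (intro prod.cong) (auto simp: config_of_def)
  also have "\<dots> = (\<Prod>x\<in>{x \<in> pverts G. x \<in> S}. \<rho>)"
    by (rule prod.inter_filter[symmetric]) simp
  also have "{x \<in> pverts G. x \<in> S} = S"
    using assms by (auto simp: independent_sets_def)
  finally show ?thesis by simp
qed

text \<open>Here and in \<open>act_Plus\<close> only moves of positive rate are treated; the others
  contribute zero to the dissipation sum.\<close>

lemma act_Minus:
  assumes "S \<in> independent_sets G" "x \<in> S"
  shows "act G (Minus x) (config_of G S) = config_of G (S - {x})"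
proof -
  have "S - {x} \<in> independent_sets G"
    using assms by (auto simp: independent_sets_def)
  moreover have "minus_delta G x (config_of G S) = config_of G (S - {x})"
    using assms by (auto simp: minus_delta_def config_of_def delta_def)
  ultimately show ?thesis by (simp add: config_of_in_configs)
qed

lemma act_Plus:
  assumes "x \<in> pverts G" "x \<notin> S" "insert x S \<in> independent_sets G"
  shows "act G (Plus x) (config_of G S) = config_of G (insert x S)"
proof -
  have "plus_delta G x (config_of G S) = config_of G (insert x S)"
    using assms by (auto simp: plus_delta_def config_of_def delta_def)
  with assms(3) show ?thesis by (simp add: config_of_in_configs)
qed

lemma rate_Minus: "x \<in> pverts G \<Longrightarrow> rate G \<rho> (config_of G S) (Minus x) = (if x \<in> S then 1 else 0)"
  by (simp add: config_of_def)

text \<open>The product is the indicator that the closed neighbourhood of \<open>x\<close> misses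
  \<open>S\<close>, which is exactly when \<open>x\<close> can be added.\<close>

lemma rate_Plus:
  assumes "S \<in> independent_sets G" "x \<in> pverts G"
  shows "rate G \<rho> (config_of G S) (Plus x)
    = (if x \<notin> S \<and> insert x S \<in> independent_sets G then \<rho> else 0)"
proof -
  have sub: "closed_nbrs G x \<subseteq> pverts G"
    using assms by (auto simp: closed_nbrs_def nbrs_def)
  then have fin: "finite (closed_nbrs G x)"
    by (rule finite_subset) simp
  have "x \<notin> S \<and> insert x S \<in> independent_sets G \<longleftrightarrow> closed_nbrs G x \<inter> S = {}"
    using assms parcsD by (fastforce simp: closed_nbrs_def nbrs_def independent_sets_def)
  moreover have "(\<Prod>y\<in>closed_nbrs G x. 1 - real_of_int (config_of G S y))
      = (if closed_nbrs G x \<inter> S = {} then 1 else 0)"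
    using sub fin by (auto simp: config_of_def intro!: prod.neutral split: if_splits)
  ultimately show ?thesis by simp
qed

lemma card_nbrs_le_max_degree: "x \<in> pverts G \<Longrightarrow> card (nbrs G x) \<le> max_degree G"
  unfolding max_degree_def by (intro cSUP_upper) auto

end

section \<open>Transfer to the hardcore model\<close>

text \<open>Reduces the inequality to a condition on two positive reals. The graph enters it through
  the degree: blocked vertices are neighbours.\<close>

lemma (in pair_graph) convex_sobolev_of_coalescence:
  assumes "0 < \<rho>" "0 < K" "convex_entropy \<phi> p q"
    and coal: "\<And>a b k. 0 < a \<Longrightarrow> 0 < b \<Longrightarrow> k \<le> max_degree G \<Longrightarrow>
      \<rho> * dissipation' p q a b (b - a) 0 + (1 - \<rho> * real k) * dissipation' p q a b 0 (a - b)
        \<le> - (K * dissipation p a b)"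
  shows "convex_sobolev G \<rho> \<phi> K"
proof -
  define I where "I = independent_sets G"
  interpret hereditary_family I \<rho>
    unfolding I_def by (rule hereditary_independent_sets) (use assms pair_graph in auto)
  interpret convex_entropy \<phi> p q by fact
  interpret entropy_dissipation I \<rho> \<phi> p q K "max_degree G"
  proof
    show "card (blocked S x) \<le> max_degree G" if x: "x \<in> free S" for S x
    proof -
      have "blocked S x \<subseteq> nbrs G x"
      proof
        fix y assume y: "y \<in> blocked S x"
        then have in_I: "insert y S \<in> I" "insert x S \<in> I" "insert y (insert x S) \<notin> I" "y \<noteq> x"
          using x by (auto simp: blocked_def free_def)
        \<comment> \<open>Since \<open>insert x S\<close> and \<open>insert y S\<close> are
          independent, the offending arc can only join \<open>x\<close> and
          \<open>y\<close>.\<close>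
        then obtain u v where "(u, v) \<in> parcs G" "u \<in> insert y (insert x S)" "v \<in> insert y (insert x S)"
          unfolding I_def independent_sets_def by blast
        then have "(y, x) \<in> parcs G"
          using in_I parcsD[of u v] unfolding I_def independent_sets_def by blast
        then show "y \<in> nbrs G x"
          using in_I parcsD by (auto simp: nbrs_def)
      qed
      then have "card (blocked S x) \<le> card (nbrs G x)"
        by (rule card_mono[rotated]) (simp add: nbrs_def)
      also have "\<dots> \<le> max_degree G"
        using freeD(2)[OF x] by (intro card_nbrs_le_max_degree) (auto simp: I_def independent_sets_def)
      finally show ?thesis .
    qed
  qed (use assms in auto)
  have I_subset: "S \<subseteq> pverts G" if "S \<in> I" for S
    using that by (simp add: I_def independent_sets_def)
  note transfer = rate_Plus[folded I_def] act_Plus[folded I_def] rate_Minus act_Minus[folded I_def]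
  have free_eq: "free S = {x \<in> pverts G. x \<notin> S \<and> insert x S \<in> I}" for S
    by (auto simp: free_def dest: I_subset)
  have sum_configs: "(\<Sum>\<eta>\<in>configs G. h \<eta>) = (\<Sum>S\<in>I. h (config_of G S))" for h :: "_ \<Rightarrow> real"
    unfolding I_def by (rule sum.reindex_bij_betw[OF bij_betw_config_of, symmetric])
  have measure: "hc_measure G \<rho> (config_of G S) = weight S" if "S \<in> I" for S
    using that by (simp add: hc_measure_def partition_fun_def sum_configs weight_def prod_config_of[folded I_def])
  show ?thesis
    unfolding convex_sobolev_def
  proof (intro allI impI)
    fix f :: "('a \<Rightarrow> int) \<Rightarrow> real" assume f: "\<forall>\<eta>\<in>configs G. 0 < f \<eta>"
    define F where "F S = f (config_of G S)" for S
    have pos: "0 < F S" if "S \<in> I" for S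
      using that f config_of_in_configs by (simp add: F_def I_def)
    have "phi_entropy G \<rho> \<phi> f = entropy F"
      by (simp add: phi_entropy_def sum_configs measure entropy_def mean_def F_def mult.commute)
    \<comment> \<open>Every edge occurs once as an addition and once as a removal; reversibility
      makes the two contributions equal.\<close>
    moreover have "(\<Sum>\<eta>\<in>configs G. \<Sum>\<sigma>\<in>moves G.
        rate G \<rho> \<eta> \<sigma> * Phi \<phi> (f \<eta>) (f (act G \<sigma> \<eta>)) * hc_measure G \<rho> \<eta>) = 2 * energy F"
    proof -
      have "(\<Sum>\<sigma>\<in>moves G. rate G \<rho> (config_of G S) \<sigma>
            * Phi \<phi> (f (config_of G S)) (f (act G \<sigma> (config_of G S))) * hc_measure G \<rho> (config_of G S))
          = weight S * (\<rho> * (\<Sum>x\<in>free S. edge F S x)) + weight S * (\<Sum>x\<in>S. edge F (S - {x}) x)"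
        (is "(\<Sum>\<sigma>\<in>_. ?t \<sigma>) = _") if S: "S \<in> I" for S
      proof -
        note SV = I_subset[OF S]
        have "(\<Sum>\<sigma>\<in>moves G. ?t \<sigma>) = (\<Sum>x\<in>pverts G. ?t (Plus x)) + (\<Sum>x\<in>pverts G. ?t (Minus x))"
          unfolding moves_def
          by (subst sum.union_disjoint) (auto simp: sum.reindex inj_on_def)
        also have "(\<Sum>x\<in>pverts G. ?t (Plus x)) = (\<Sum>x\<in>free S. ?t (Plus x))"
          by (rule sum.mono_neutral_right)
            (use S in \<open>auto simp: free_eq transfer simp del: rate.simps act.simps\<close>)
        also have "\<dots> = (\<Sum>x\<in>free S. weight S * (\<rho> * edge F S x))"
          using S by (intro sum.cong refl)
            (auto simp: free_eq transfer measure edge_def Phi_eq_dissipation pos simp flip: F_def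
              simp del: rate.simps act.simps)
        also have "(\<Sum>x\<in>pverts G. ?t (Minus x)) = (\<Sum>x\<in>S. ?t (Minus x))"
          by (rule sum.mono_neutral_right)
            (use SV in \<open>auto simp: transfer simp del: rate.simps act.simps\<close>)
        also have "\<dots> = (\<Sum>x\<in>S. weight S * edge F (S - {x}) x)"
        proof (intro sum.cong refl)
          fix x assume x: "x \<in> S"
          have "Phi \<phi> (F S) (F (S - {x})) = edge F (S - {x}) x"
            using x S pos Diff_in_I
            by (simp add: Phi_eq_dissipation edge_def insert_absorb diss_commute)
          then show "?t (Minus x) = weight S * edge F (S - {x}) x"
            using x S SV by (auto simp: transfer measure simp flip: F_def
              simp del: rate.simps act.simps)
        qed
        finally show ?thesis by (simp add: sum_distrib_left)
      qed
      then have "(\<Sum>\<eta>\<in>configs G. \<Sum>\<sigma>\<in>moves G.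
          rate G \<rho> \<eta> \<sigma> * Phi \<phi> (f \<eta>) (f (act G \<sigma> \<eta>)) * hc_measure G \<rho> \<eta>)
          = energy F + (\<Sum>S\<in>I. weight S * (\<Sum>x\<in>S. edge F (S - {x}) x))"
        by (simp add: sum_configs energy_def sum.distrib)
      also have "(\<Sum>S\<in>I. weight S * (\<Sum>x\<in>S. edge F (S - {x}) x))
          = (\<Sum>S\<in>I. weight S * (\<rho> * (\<Sum>x\<in>free S. edge F (insert x S - {x}) x)))"
        by (rule sum_remove_eq_sum_add)
      also have "\<dots> = energy F"
        unfolding energy_def
        by (intro sum.cong arg_cong2[where f = "(*)"] refl) (auto simp: free_def)
      finally show ?thesis by simp
    qed
    ultimately show "K * phi_entropy G \<rho> \<phi> f \<le> 1 / 2 * (\<Sum>\<eta>\<in>configs G. \<Sum>\<sigma>\<in>moves G.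
        rate G \<rho> \<eta> \<sigma> * Phi \<phi> (f \<eta>) (f (act G \<sigma> \<eta>)) * hc_measure G \<rho> \<eta>)"
      using entropy_le_energy[of F] pos by simp
  qed
qed

text \<open>The three claims differ only in how the coalescence terms are estimated.\<close>

theorem theorem5p2:
  fixes G :: "'v pair_pre_digraph" and \<rho> \<kappa> \<kappa>bar :: real and \<Delta> :: nat
  assumes "pair_graph G"
    and "Digraph_Component.connected (with_proj G)"
    and "\<Delta> = max_degree G"
    and "0 < \<rho>"
    and "\<rho> * real \<Delta> \<le> 1"
    and "\<kappa> = 1 - \<rho> * (real \<Delta> - 1)"
    and "\<kappa>bar = min \<rho> (1 - \<rho> * real \<Delta>)"
  shows "(\<forall>\<phi>. admissible \<phi> \<longrightarrow> convex_sobolev G \<rho> \<phi> \<kappa>) \<and>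
         modified_log_sobolev G \<rho> (\<kappa> + 2 * \<kappa>bar) \<and>
         (\<forall>\<alpha>. 1 < \<alpha> \<and> \<alpha> \<le> 2 \<longrightarrow> beckner G \<rho> \<alpha> (\<alpha> * \<kappa>))"
proof -
  interpret pair_graph G by fact
  have \<kappa>: "0 < \<kappa>" and \<kappa>bar: "0 \<le> \<kappa>bar"
    using assms by (auto simp: algebra_simps)
  \<comment> \<open>\<open>k\<close> counts blocked vertices, so replacing it by
    \<open>\<Delta>\<close> bounds the leftover removal rate and the total coalescence rate from
    below.\<close>
  have rate: "0 \<le> 1 - \<rho> * real k" "\<kappa>bar \<le> 1 - \<rho> * real k" "\<kappa> \<le> \<rho> + (1 - \<rho> * real k)"
    if "k \<le> max_degree G" for k
  proof -
    have "\<rho> * real k \<le> \<rho> * real \<Delta>"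
      using that assms by (intro mult_left_mono) auto
    moreover have "\<kappa> = 1 + \<rho> - \<rho> * real \<Delta>" "\<kappa>bar \<le> 1 - \<rho> * real \<Delta>"
      using assms(6,7) by (simp_all add: right_diff_distrib)
    ultimately show "0 \<le> 1 - \<rho> * real k" "\<kappa>bar \<le> 1 - \<rho> * real k" "\<kappa> \<le> \<rho> + (1 - \<rho> * real k)"
      using assms(5) by linarith+
  qed
  have "convex_sobolev G \<rho> \<phi> \<kappa>" if "admissible \<phi>" for \<phi>
  proof (rule convex_sobolev_of_coalescence[OF \<open>0 < \<rho>\<close> \<kappa> convex_entropy_admissible[OF that]])
    interpret convex_entropy \<phi> "deriv \<phi>" "deriv (deriv \<phi>)"
      by (rule convex_entropy_admissible[OF that])
    fix a b :: real and k assume ab: "0 < a" "0 < b" and k: "k \<le> max_degree G"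
    have "\<rho> * diss' a b (b - a) 0 + (1 - \<rho> * real k) * diss' a b 0 (a - b)
        \<le> - ((\<rho> + (1 - \<rho> * real k)) * diss a b)"
      using ab rate(1)[OF k] \<open>0 < \<rho>\<close> by (intro coalescence_le) auto
    also have "\<dots> \<le> - (\<kappa> * diss a b)"
      using mult_right_mono[OF rate(3)[OF k] diss_nonneg[OF ab]] by simp
    finally show "\<rho> * diss' a b (b - a) 0 + (1 - \<rho> * real k) * diss' a b 0 (a - b)
        \<le> - (\<kappa> * diss a b)" .
  qed
  moreover have "modified_log_sobolev G \<rho> (\<kappa> + 2 * \<kappa>bar)"
    unfolding modified_log_sobolev_def
  proof (rule convex_sobolev_of_coalescence[OF \<open>0 < \<rho>\<close> _ convex_entropy_log])
    interpret convex_entropy phi_log ln "\<lambda>a. 1 / a" by (rule convex_entropy_log)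
    fix a b :: real and k assume ab: "0 < a" "0 < b" and k: "k \<le> max_degree G"
    \<comment> \<open>Both coalescence rates are at least \<open>\<kappa>bar\<close>, so the terms
      in \<open>q\<close> contribute an additional
      \<open>2 * \<kappa>bar * diss a b\<close>.\<close>
    have "\<kappa>bar * (2 * diss a b) \<le> \<kappa>bar * ((1 / a + 1 / b) * (b - a)\<^sup>2)"
      using ln_diff_mult_le[OF ab] \<kappa>bar by (intro mult_left_mono) (simp_all add: dissipation_def)
    also have "\<dots> = (\<kappa>bar * (1 / a) + \<kappa>bar * (1 / b)) * (b - a)\<^sup>2"
      by (simp add: algebra_simps)
    also have "\<dots> \<le> (\<rho> * (1 / a) + (1 - \<rho> * real k) * (1 / b)) * (b - a)\<^sup>2"
      using ab rate(2)[OF k] assms(7) by (intro mult_right_mono add_mono) auto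
    finally have "\<kappa>bar * (2 * diss a b) \<le> (\<rho> * (1 / a) + (1 - \<rho> * real k) * (1 / b)) * (b - a)\<^sup>2" .
    moreover have "\<kappa> * diss a b \<le> (\<rho> + (1 - \<rho> * real k)) * diss a b"
      by (rule mult_right_mono[OF rate(3)[OF k] diss_nonneg[OF ab]])
    ultimately show "\<rho> * diss' a b (b - a) 0 + (1 - \<rho> * real k) * diss' a b 0 (a - b)
        \<le> - ((\<kappa> + 2 * \<kappa>bar) * diss a b)"
      unfolding coalescence_eq by (simp add: distrib_right)
  qed (use \<kappa> \<kappa>bar in simp)
  moreover have "beckner G \<rho> \<alpha> (\<alpha> * \<kappa>)" if \<alpha>: "1 < \<alpha>" "\<alpha> \<le> 2" for \<alpha>
    unfolding beckner_def
  proof (rule convex_sobolev_of_coalescence[OF \<open>0 < \<rho>\<close> _ convex_entropy_power[OF \<alpha>]])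
    let ?p = "\<lambda>a. 1 / (\<alpha> - 1) * (\<alpha> * a powr (\<alpha> - 1) - 1) - 1" and ?q = "\<lambda>a. \<alpha> * a powr (\<alpha> - 2)"
    interpret convex_entropy "phi_power \<alpha>" ?p ?q
      by (rule convex_entropy_power[OF \<alpha>])
    fix a b :: real and k assume ab: "0 < a" "0 < b" and k: "k \<le> max_degree G"
    \<comment> \<open>At either end the term in \<open>q\<close> is worth
      \<open>\<alpha> - 1\<close> further copies of \<open>diss a b\<close>, which raises the factor
      from \<open>1\<close> to \<open>\<alpha>\<close>.\<close>
    have gain: "(\<alpha> - 1) * diss a b \<le> ?q a * (b - a)\<^sup>2" if "0 < a" "0 < b" for a b
    proof -
      have "diss a b = \<alpha> / (\<alpha> - 1) * ((b powr (\<alpha> - 1) - a powr (\<alpha> - 1)) * (b - a))"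
        by (simp add: dissipation_def algebra_simps diff_divide_distrib)
      then have "(\<alpha> - 1) * diss a b = \<alpha> * ((b powr (\<alpha> - 1) - a powr (\<alpha> - 1)) * (b - a))"
        using \<alpha> by simp
      also have "\<dots> \<le> \<alpha> * (a powr (\<alpha> - 2) * (b - a)\<^sup>2)"
        using \<alpha> that by (intro mult_left_mono powr_dissipation_le) auto
      finally show ?thesis by (simp add: mult.assoc)
    qed
    have "\<rho> * ((\<alpha> - 1) * diss a b) \<le> \<rho> * (?q a * (b - a)\<^sup>2)"
      using gain[OF ab] \<open>0 < \<rho>\<close> by (intro mult_left_mono) auto
    moreover have "(1 - \<rho> * real k) * ((\<alpha> - 1) * diss a b) \<le> (1 - \<rho> * real k) * (?q b * (b - a)\<^sup>2)"
      using gain[OF ab(2,1)] rate(1)[OF k] unfolding diss_commute[of b a] power2_commute[of a b]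
      by (intro mult_left_mono)
    moreover have "\<alpha> * (\<kappa> * diss a b) \<le> \<alpha> * ((\<rho> + (1 - \<rho> * real k)) * diss a b)"
      using \<alpha> by (intro mult_left_mono mult_right_mono rate(3)[OF k] diss_nonneg ab) auto
    ultimately show "\<rho> * diss' a b (b - a) 0 + (1 - \<rho> * real k) * diss' a b 0 (a - b)
        \<le> - (\<alpha> * \<kappa> * diss a b)"
      unfolding coalescence_eq by (simp add: algebra_simps)
  qed (use \<alpha> \<kappa> in simp)
  ultimately show ?thesis by blast
qed

end
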